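(* Let $\mathcal C=\{n\ge1:\ 2^{n+1}-1\equiv 2^j\pmod n \text{ for some integer } j\ge1\}$. Then $$\#\big(\mathcal C\cap[1,x]\big)\ll \frac{x}{(\log\log x)^{1/7}}$$ holds for all real $x>e^{e}$, with an absolute implied constant. In particular $\mathcal C$ has asymptotic density zero.
   Context: $\log x$ denotes $\max\{\ln x,1\}$. The notation $A\ll B$ means $|A|\le cB$ for an absolute constant $c>0$. *)

theory Defs
  imports "HOL-Number_Theory.Number_Theory"
begin

text \<open>The paper's convention: log x denotes max (ln x) 1.\<close>
definition mlog :: "real \<Rightarrow> real" where
  "mlog x = max (ln x) 1"

definition setC :: "nat set" where
  "setC = {n. n \<ge> 1 \<and> (\<exists>j::nat. j \<ge> 1 \<and> [(2::int)^(n+1) - 1 = 2^j] (mod int n))}"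

end

(*
  Let f_p(n) be the Legendre symbol of 2^(n+1) - 1 modulo p.  If n is in the set C and p is an odd
  prime factor of n, then 2^(n+1) - 1 is congruent to 2^j modulo p with the same j for all p, so
  f_p(n) = (2|p)^j: the sum of f_p(n) over the prime factors p of n with (2|p) = 1, and likewise
  over those with (2|p) = -1, has no cancellation.  On the other hand, for p < q the average of
  f_p(n) f_q(n) over the multiples n of pq is small once ord_p(2) >= p^(5/8): along progressions on
  which f_q is constant, f_p runs over a coset of a large subgroup, and the corresponding character
  sum is at most sqrt p.  Hence the sum of f_p(n) is small in mean square.

  If ord_p(2) < p^(5/8), then a much simpler first moment works, because 2^a - 1 is rarely a power
  of 2 modulo p.  Otherwise many pairs a, a + k with small k would both be hit; that puts some
  quotient (2^k' - 1)/(2^k - 1) with small k, k' into the group generated by 2 modulo p, and since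
  this quotient is multiplicatively independent of 2, a pigeonhole argument shows that such
  (exceptional) p are very sparse.

  The primes used lie between a power of log x and x^(1/8).  The sum M of their reciprocals is of
  order log log x, almost all n have at least M/2 of them as prime factors (Turan), and so C has
  O(x / sqrt (log log x)) elements up to x, more than enough for the exponent 1/7.
*)
theory Submission
  imports Defs "HOL-Real_Asymp.Real_Asymp" "HOL-Analysis.Harmonic_Numbers"
begin

subsection \<open>Character sums over orbits\<close>

text \<open>The threshold p^(5/8) is one choice of p^t with 1/2 < t < 2/3. The character sum bound
  sqrt p beats the orbit length ord_p(2) only if t > 1/2. The pigeonhole step uses J of size p^(t/2)
  and allows about J^3 exceptional primes, which is fewer than p only if t < 2/3. For t = 5/8 the
  savings are p^(1/8) and p^(1/16).

  The obstacle in the mean square is that the orbit of f_p along a progression with difference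
  ord_q(2) has length only ord_p(2) / gcd(ord_p(2), ord_q(2)), possibly very short. No single pair
  p, q is controlled. Instead the gcd is replaced by gcd(p - 1, q - 1) and averaged over q, which
  costs a factor log x times the number of divisors of p - 1. The saving p^(1/8) is split: one
  p^(1/16) makes the remaining divisor sum converge, the other one has to beat log x.

  This explains the lower bound 2^(16 * a) for the primes: it turns p^(-1/16) into at most 2^(-a),
  both here and for the exceptional primes, and 2^a of size at least (log x)^2 suffices. As only log
  log of the ends of the range matters, crude bounds for the sum of 1/p are enough.\<close>

abbreviation chi :: "nat \<Rightarrow> int \<Rightarrow> int" where
  "chi p a \<equiv> Legendre a (int p)"

lemma chi_cong: "[a = b] (mod int p) \<Longrightarrow> chi p a = chi p b"
proof -
  assume ab: "[a = b] (mod int p)"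
  then have "[a = 0] (mod int p) \<longleftrightarrow> [b = 0] (mod int p)"
    using cong_sym cong_trans by blast
  moreover have "[y\<^sup>2 = a] (mod int p) \<longleftrightarrow> [y\<^sup>2 = b] (mod int p)" for y
    using ab cong_sym cong_trans by blast
  ultimately show ?thesis
    by (simp add: Legendre_def QuadRes_def)
qed

lemma chi_values: "chi p a \<in> {-1, 0, 1}"
  by (simp add: Legendre_def)

lemma abs_chi_le: "\<bar>chi p a\<bar> \<le> 1"
  by (simp add: Legendre_def)

lemma chi_eq_0_iff: "chi p a = 0 \<longleftrightarrow> int p dvd a"
  by (simp add: Legendre_def cong_0_iff)

lemma chi_square: "\<not> int p dvd a \<Longrightarrow> chi p a * chi p a = 1"
  by (simp add: Legendre_def cong_0_iff)

text \<open>Euler's criterion gives the identity modulo \<open>p\<close>; both sides lie in {-1, 0,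
  1}, so they differ by at most 2 < \<open>p\<close> and must be equal.\<close>

lemma chi_mult:
  assumes "prime p" "2 < p"
  shows "chi p (a * b) = chi p a * chi p b"
proof -
  let ?k = "(p - 1) div 2"
  have "[chi p (a * b) = (a * b) ^ ?k] (mod int p)"
    using euler_criterion[OF assms] .
  also have "(a * b) ^ ?k = a ^ ?k * b ^ ?k"
    by (rule power_mult_distrib)
  also have "[a ^ ?k * b ^ ?k = chi p a * chi p b] (mod int p)"
    by (intro cong_mult cong_sym[OF euler_criterion[OF assms]])
  finally have d: "int p dvd chi p (a * b) - chi p a * chi p b"
    by (simp add: cong_iff_dvd_diff)
  have "\<bar>chi p a * chi p b\<bar> \<le> 1"
    using chi_values[of a p] chi_values[of b p] by auto
  then have "\<bar>chi p (a * b) - chi p a * chi p b\<bar> \<le> 2"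
    using abs_chi_le[of "a * b" p] by linarith
  then have "\<bar>chi p (a * b) - chi p a * chi p b\<bar> < int p"
    using assms(2) by linarith
  with d show ?thesis
    using zdvd_not_zless[of "\<bar>chi p (a * b) - chi p a * chi p b\<bar>" "int p"] by force
qed

lemma chi_one: "prime p \<Longrightarrow> chi p 1 = 1"
proof -
  assume p: "prime p"
  then have "\<not> [1 = 0] (mod int p)"
    using not_prime_1 by (auto simp: cong_0_iff)
  moreover have "QuadRes (int p) 1"
    unfolding QuadRes_def by (rule exI[of _ 1]) simp
  ultimately show ?thesis by (simp add: Legendre_def)
qed

lemma chi_power:
  assumes "prime p" "2 < p"
  shows "chi p (a ^ k) = chi p a ^ k"
  by (induction k) (simp_all add: chi_one chi_mult assms)

text \<open>Otherwise squaring would be surjective on the residues, hence injective, although 1 and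
  \<open>p - 1\<close> have the same square.\<close>

lemma ex_chi_minus_one:
  assumes "prime p" "2 < p"
  shows "\<exists>g. chi p g = -1"
proof (rule ccontr)
  assume "\<not> ?thesis"
  then have all: "QuadRes (int p) g \<or> [g = 0] (mod int p)" for g
    by (auto simp: Legendre_def split: if_splits)
  let ?sq = "\<lambda>y. y\<^sup>2 mod int p"
  have "g \<in> ?sq ` {0..<int p}" if g: "g \<in> {0..<int p}" for g
  proof -
    obtain y where "[y\<^sup>2 = g] (mod int p)"
      using all[of g] unfolding QuadRes_def
      by (metis cong_sym zero_power2)
    then have "(y mod int p)\<^sup>2 mod int p = g"
      using g by (simp add: unique_euclidean_semiring_class.cong_def power_mod)
    moreover have "y mod int p \<in> {0..<int p}" using assms by simp
    ultimately show ?thesis by blast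
  qed
  then have "?sq ` {0..<int p} = {0..<int p}"
    using assms by auto
  then have "inj_on ?sq {0..<int p}"
    by (simp add: eq_card_imp_inj_on)
  moreover have "?sq (int p - 1) = ?sq 1"
  proof -
    have "(int p - 1)\<^sup>2 = 1 + int p * (int p - 2)"
      by (simp add: power2_eq_square algebra_simps)
    then show ?thesis by (metis mod_mult_self2 one_power2)
  qed
  ultimately have "int p - 1 = 1"
    by (rule inj_onD) (use assms in auto)
  with assms show False by simp
qed

lemma bij_betw_affine_mod:
  fixes b s :: int
  assumes "m > 0" "coprime b (int m)"
  shows "bij_betw (\<lambda>c. (b * c + s) mod int m) {0..<int m} {0..<int m}"
proof -
  have inj: "inj_on (\<lambda>c. (b * c + s) mod int m) {0..<int m}"
  proof (rule inj_onI)
    fix c c' assume *: "c \<in> {0..<int m}" "c' \<in> {0..<int m}"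
      "(b * c + s) mod int m = (b * c' + s) mod int m"
    then have "[b * c + s = b * c' + s] (mod int m)"
      by (simp add: unique_euclidean_semiring_class.cong_def)
    then have "[b * c = b * c'] (mod int m)"
      by (simp add: cong_add_rcancel)
    then have "[c = c'] (mod int m)"
      using assms(2) by (simp add: cong_mult_lcancel)
    with * show "c = c'"
      by (auto intro: cong_less_imp_eq_int)
  qed
  have "(\<lambda>c. (b * c + s) mod int m) ` {0..<int m} = {0..<int m}"
    by (rule endo_inj_surj[OF _ _ inj]) (use assms in auto)
  with inj show ?thesis by (simp add: bij_betw_def)
qed

lemma sum_residues_affine:
  fixes h :: "int \<Rightarrow> int" and b s :: int
  assumes "m > 0" "coprime b (int m)"
    and h: "\<And>x y. [x = y] (mod int m) \<Longrightarrow> h x = h y"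
  shows "(\<Sum>c\<in>{0..<int m}. h (b * c + s)) = (\<Sum>c\<in>{0..<int m}. h c)"
proof -
  have "(\<Sum>c\<in>{0..<int m}. h (b * c + s)) = (\<Sum>c\<in>{0..<int m}. h ((b * c + s) mod int m))"
    by (intro sum.cong refl h) (simp add: cong_def)
  also have "\<dots> = (\<Sum>c\<in>{0..<int m}. h c)"
    by (rule sum.reindex_bij_betw[OF bij_betw_affine_mod[OF assms(1,2)]])
  finally show ?thesis .
qed

lemma coprime_of_not_dvd: "prime p \<Longrightarrow> \<not> int p dvd a \<Longrightarrow> coprime a (int p)"
  by (metis coprime_commute prime_imp_coprime prime_nat_int_transfer)

text \<open>Multiplication by a non-residue permutes the residues and changes the sign of the
  sum.\<close>

lemma sum_chi:
  assumes "prime p" "2 < p"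
  shows "(\<Sum>c\<in>{0..<int p}. chi p c) = 0"
proof -
  obtain g where g: "chi p g = -1" using ex_chi_minus_one[OF assms] by blast
  then have "\<not> int p dvd g" using chi_eq_0_iff[of g p] by force
  then have "(\<Sum>c\<in>{0..<int p}. chi p c) = (\<Sum>c\<in>{0..<int p}. chi p (g * c + 0))"
    using sum_residues_affine[of p g "chi p" 0] assms chi_cong coprime_of_not_dvd
    by (simp add: prime_gt_0_nat)
  also have "\<dots> = - (\<Sum>c\<in>{0..<int p}. chi p c)"
    by (simp add: chi_mult assms g sum_negf)
  finally show ?thesis by simp
qed

text \<open>The sums over all shifts add up to zero, and scaling shows that all nonzero shifts
  contribute equally.\<close>
lemma sum_chi_shift:
  assumes p: "prime p" "2 < p" and e: "\<not> int p dvd e"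
  shows "(\<Sum>v\<in>{0..<int p}. chi p v * chi p (v + e)) = -1"
proof -
  define S where "S e = (\<Sum>v\<in>{0..<int p}. chi p v * chi p (v + e))" for e
  have S_eq: "S e = S 1" if e: "\<not> int p dvd e" for e
  proof -
    have "S e = (\<Sum>v\<in>{0..<int p}. chi p (e * v + 0) * chi p ((e * v + 0) + e))"
      unfolding S_def
      by (rule sum_residues_affine[where h = "\<lambda>v. chi p v * chi p (v + e)", symmetric])
        (use p e in \<open>auto intro!: coprime_of_not_dvd arg_cong2[where f = times] chi_cong
            simp: prime_gt_0_nat cong_add_rcancel\<close>)
    also have "\<dots> = (\<Sum>v\<in>{0..<int p}. chi p e * chi p e * (chi p v * chi p (v + 1)))"
    proof (intro sum.cong refl)
      fix v :: int
      have "chi p ((e * v + 0) + e) = chi p e * chi p (v + 1)"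
        using chi_mult[OF p, of e "v + 1"] by (simp add: algebra_simps)
      then show "chi p (e * v + 0) * chi p ((e * v + 0) + e)
          = chi p e * chi p e * (chi p v * chi p (v + 1))"
        by (simp add: chi_mult[OF p])
    qed
    also have "\<dots> = S 1"
      using chi_square[OF e] by (simp add: S_def)
    finally show ?thesis .
  qed
  have S0: "S 0 = int p - 1"
  proof -
    have "S 0 = (\<Sum>v\<in>{0..<int p}. if v = 0 then 0 else 1)"
      unfolding S_def
    proof (intro sum.cong refl)
      fix v assume v: "v \<in> {0..<int p}"
      show "chi p v * chi p (v + 0) = (if v = 0 then 0 else 1)"
      proof (cases "v = 0")
        case False
        with v have "\<not> int p dvd v" using zdvd_not_zless[of v "int p"] by auto
        with False show ?thesis by (simp add: chi_square)
      qed (use chi_eq_0_iff[of 0 p] in simp)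
    qed
    also have "\<dots> = (\<Sum>v\<in>{1..<int p}. 1)"
      by (rule sum.mono_neutral_cong_right) auto
    finally show ?thesis using p by simp
  qed
  have "(\<Sum>e\<in>{0..<int p}. S e) = (\<Sum>v\<in>{0..<int p}. chi p v * (\<Sum>e\<in>{0..<int p}. chi p (1 * e + v)))"
    unfolding S_def by (subst sum.swap) (simp add: sum_distrib_left add.commute)
  also have "\<dots> = 0"
    using sum_residues_affine[of p 1 "chi p"] p sum_chi[OF p]
    by (simp add: prime_gt_0_nat chi_cong)
  finally have "0 = (\<Sum>e\<in>{0..<int p}. S e)" by simp
  also have "{0..<int p} = insert 0 {1..<int p}" using p by auto
  also have "(\<Sum>e\<in>\<dots>. S e) = S 0 + (\<Sum>e\<in>{1..<int p}. S e)" by simp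
  also have "(\<Sum>e\<in>{1..<int p}. S e) = (\<Sum>e\<in>{1..<int p}. S 1)"
    by (intro sum.cong refl S_eq) (simp add: zdvd_not_zless)
  finally have "S 0 + (int p - 1) * S 1 = 0"
    using p by (simp add: of_nat_diff)
  then have "(int p - 1) * (S 1 + 1) = 0"
    unfolding S0 by (simp add: algebra_simps)
  then have "S 1 = -1"
    using p by (simp only: mult_eq_0_iff) linarith
  with S_eq[OF e] show ?thesis by (simp add: S_def)
qed

lemma sum_periodic_shift:
  fixes F :: "nat \<Rightarrow> 'a :: ab_group_add"
  assumes "F D = F 0"
  shows "(\<Sum>t<D. F (Suc t)) = (\<Sum>t<D. F t)"
  using sum.lessThan_Suc_shift[of F D] sum.lessThan_Suc[of F D] assms
  by (simp add: add.commute)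

text \<open>The sum \<open>V c\<close> below has the same absolute value at all elements \<open>c\<close> of the
  subgroup generated by \<open>z\<close>, so the mean square of \<open>V\<close> over all residues already controls \<open>V 1\<close>.\<close>
lemma charsum_orbit_bound:
  fixes p w z :: nat
  assumes p: "prime p" "2 < p" and w: "coprime w p" and z: "coprime p z"
  shows "(\<Sum>t<ord p z. chi p (int w * int z ^ t - 1))\<^sup>2 \<le> int p"
proof -
  define D where "D = ord p z"
  define h where "h t = int w * int z ^ t" for t
  define V where "V c = (\<Sum>t<D. chi p (h t - c))" for c
  have D: "D > 0" using z by (simp add: D_def)
  have z': "\<not> int p dvd int z"
    using z p by (metis coprime_absorb_left int_dvd_int_iff not_prime_unit)
  have w': "\<not> int p dvd int w"
    using w p by (metis coprime_absorb_right int_dvd_int_iff not_prime_unit)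
  have hD: "[h D = h 0] (mod int p)"
  proof -
    have "[int (z ^ D) = int 1] (mod int p)"
      using ord[of z p] unfolding cong_int_iff D_def .
    from cong_mult[OF cong_refl[of "int w"] this] show ?thesis
      by (simp add: h_def)
  qed
  have V_step: "V (int z * c) = chi p (int z) * V c" for c
  proof -
    have "V (int z * c) = (\<Sum>t<D. chi p (h (Suc t) - int z * c))"
      unfolding V_def by (rule sum_periodic_shift[symmetric]) (intro chi_cong cong_diff hD cong_refl)
    also have "\<dots> = (\<Sum>t<D. chi p (int z) * chi p (h t - c))"
    proof (intro sum.cong refl)
      fix t
      have "h (Suc t) - int z * c = int z * (h t - c)"
        by (simp add: h_def algebra_simps)
      then show "chi p (h (Suc t) - int z * c) = chi p (int z) * chi p (h t - c)"
        by (simp add: chi_mult[OF p])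
    qed
    finally show ?thesis by (simp add: V_def sum_distrib_left)
  qed
  have V_orbit: "(V (int z ^ s))\<^sup>2 = (V 1)\<^sup>2" for s
  proof (induction s)
    case (Suc s)
    have "(V (int z ^ Suc s))\<^sup>2 = (chi p (int z) * chi p (int z)) * (V (int z ^ s))\<^sup>2"
      by (simp add: V_step power2_eq_square)
    then show ?case using Suc.IH chi_square[OF z'] by simp
  qed simp
  have V_cong: "V c = V c'" if "[c = c'] (mod int p)" for c c'
    unfolding V_def by (intro sum.cong refl chi_cong cong_diff cong_refl that)
  have inj: "inj_on (\<lambda>s. int z ^ s mod int p) {..<D}"
    using inj_power_mod[OF z] unfolding D_def inj_on_def
    by (metis of_nat_eq_iff of_nat_mod of_nat_power)
  have "int D * (V 1)\<^sup>2 = (\<Sum>s<D. (V (int z ^ s mod int p))\<^sup>2)"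
  proof -
    have "V (int z ^ s mod int p) = V (int z ^ s)" for s
      by (rule V_cong) (simp add: unique_euclidean_semiring_class.cong_def)
    then show ?thesis by (simp add: V_orbit)
  qed
  also have "\<dots> = (\<Sum>c\<in>(\<lambda>s. int z ^ s mod int p) ` {..<D}. (V c)\<^sup>2)"
    by (simp add: sum.reindex[OF inj])
  also have "\<dots> \<le> (\<Sum>c\<in>{0..<int p}. (V c)\<^sup>2)"
    by (intro sum_mono2) (use p in auto)
  also have "\<dots> = (\<Sum>t<D. \<Sum>t'<D. \<Sum>c\<in>{0..<int p}. chi p (h t - c) * chi p (h t' - c))"
    unfolding V_def power2_eq_square sum_product
    by (subst sum.swap, rule sum.cong[OF refl], rule sum.swap)
  \<comment> \<open>For distinct \<open>t\<close>, \<open>t'\<close> below the order,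
    \<open>h t\<close> and \<open>h t'\<close> are different modulo \<open>p\<close>;
    \<open>sum_chi_shift\<close> then evaluates the inner sum to -1, which is bounded by 0.\<close>
  also have "\<dots> \<le> (\<Sum>t<D. \<Sum>t'<D. if t = t' then int p else 0)"
  proof (intro sum_mono)
    fix t t' assume t: "t \<in> {..<D}" "t' \<in> {..<D}"
    show "(\<Sum>c\<in>{0..<int p}. chi p (h t - c) * chi p (h t' - c)) \<le> (if t = t' then int p else 0)"
    proof (cases "t = t'")
      case True
      have "(\<Sum>c\<in>{0..<int p}. chi p (h t - c) * chi p (h t' - c)) \<le> (\<Sum>c\<in>{0..<int p}. 1)"
      proof (intro sum_mono)
        fix c
        show "chi p (h t - c) * chi p (h t' - c) \<le> 1"
          using chi_values[of "h t' - c" p] True by auto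
      qed
      with True show ?thesis by simp
    next
      case False
      have "\<not> int p dvd h t' - h t"
      proof
        assume "int p dvd h t' - h t"
        then have "[int w * int z ^ t' = int w * int z ^ t] (mod int p)"
          by (simp add: h_def cong_iff_dvd_diff)
        then have "[int z ^ t' = int z ^ t] (mod int p)"
          using coprime_of_not_dvd[OF p(1) w'] by (simp add: cong_mult_lcancel)
        then have "int z ^ t' mod int p = int z ^ t mod int p"
          by (simp add: unique_euclidean_semiring_class.cong_def)
        with inj_onD[OF inj] t False show False by blast
      qed
      then have "-1 = (\<Sum>v\<in>{0..<int p}. chi p v * chi p (v + (h t' - h t)))"
        using sum_chi_shift[OF p] by simp
      also have "\<dots> = (\<Sum>c\<in>{0..<int p}. chi p (-1 * c + h t) * chi p ((-1 * c + h t) + (h t' - h t)))"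
        by (rule sum_residues_affine[where h = "\<lambda>v. chi p v * chi p (v + (h t' - h t))", symmetric])
          (use p in \<open>auto intro!: arg_cong2[where f = times] chi_cong cong_add simp: prime_gt_0_nat\<close>)
      also have "\<dots> = (\<Sum>c\<in>{0..<int p}. chi p (h t - c) * chi p (h t' - c))"
        by (intro sum.cong refl) (simp add: algebra_simps)
      finally show ?thesis using False by simp
    qed
  qed
  also have "\<dots> = int D * int p" by simp
  finally have "int D * (V 1)\<^sup>2 \<le> int D * int p" .
  with D have "(V 1)\<^sup>2 \<le> int p" by simp
  then show ?thesis by (simp add: V_def h_def D_def)
qed

text \<open>There are at most \<open>T / D\<close> full periods, each bounded by \<open>B\<close>,
  and the last incomplete period is bounded trivially by \<open>D\<close>. The induction peels off
  one period at a time.\<close>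

lemma abs_sum_periodic_le:
  fixes F :: "nat \<Rightarrow> real"
  assumes D: "D > 0" and per: "\<And>t. F (t + D) = F t" and F1: "\<And>t. \<bar>F t\<bar> \<le> 1"
    and B: "\<bar>\<Sum>t<D. F t\<bar> \<le> B"
  shows "\<bar>\<Sum>t<T. F t\<bar> \<le> real T / real D * B + real D"
proof (induction T rule: less_induct)
  case (less T)
  have B0: "B \<ge> 0" using B by linarith
  show ?case
  proof (cases "T < D")
    case True
    have "\<bar>\<Sum>t<T. F t\<bar> \<le> (\<Sum>t<T. \<bar>F t\<bar>)" by (rule sum_abs)
    also have "\<dots> \<le> (\<Sum>t<T. 1)" by (intro sum_mono F1)
    finally have "\<bar>\<Sum>t<T. F t\<bar> \<le> real D" using True by simp
    moreover have "real T / real D * B \<ge> 0" using B0 by simp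
    ultimately show ?thesis by linarith
  next
    case False
    then obtain S where S: "T = D + S" using le_Suc_ex not_less by blast
    have "(\<Sum>t<T. F t) = (\<Sum>t<D. F t) + (\<Sum>t<S. F (t + D))"
      unfolding S by (induction S) (simp_all add: add.commute add.left_commute)
    also have "(\<Sum>t<S. F (t + D)) = (\<Sum>t<S. F t)" by (simp add: per)
    finally have "\<bar>\<Sum>t<T. F t\<bar> \<le> B + \<bar>\<Sum>t<S. F t\<bar>"
      using B by linarith
    also have "\<dots> \<le> B + (real S / real D * B + real D)"
      using less.IH[of S] D S by simp
    also have "\<dots> = real T / real D * B + real D"
      using D by (simp add: S field_simps)
    finally show ?thesis .
  qed
qed

section \<open>Correlation of the symbols of 2^(n+1) - 1 at two primes\<close>

definition lsym :: "nat \<Rightarrow> nat \<Rightarrow> real" where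
  "lsym p n = real_of_int (chi p (2 ^ (n + 1) - 1))"

lemma abs_lsym_le: "\<bar>lsym p n\<bar> \<le> 1"
  using chi_values[of "2 ^ (n + 1) - 1" p] by (auto simp: lsym_def)

lemma coprime_2_prime: "prime p \<Longrightarrow> 2 < p \<Longrightarrow> coprime p (2::nat)"
  using prime_odd_nat[of p] by simp

lemma lsym_cong:
  assumes "prime p" "2 < p" "[n = n'] (mod ord p 2)"
  shows "lsym p n = lsym p n'"
proof -
  have "[n + 1 = n' + 1] (mod ord p 2)"
    using assms(3) cong_add_rcancel_nat by blast
  then have "[2 ^ (n + 1) = 2 ^ (n' + 1 :: nat)] (mod p)"
    using order_divides_expdiff[OF coprime_2_prime[OF assms(1,2)]] by blast
  then have "[int (2 ^ (n + 1)) = int (2 ^ (n' + 1))] (mod int p)"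
    by (simp only: cong_int_iff)
  then show ?thesis
    unfolding lsym_def by (simp add: chi_cong[OF cong_diff])
qed

lemma ord_dvd_prime_minus_1: "prime p \<Longrightarrow> 2 < p \<Longrightarrow> ord p 2 dvd p - 1"
  using order_divides_totient[OF coprime_2_prime] by (simp add: totient_prime)

lemma ord_2_bounds:
  assumes "prime p" "2 < p"
  shows "0 < ord p 2" "ord p 2 < p"
  using dvd_imp_le[OF ord_dvd_prime_minus_1[OF assms]] assms coprime_2_prime[OF assms]
  by auto

text \<open>Along a progression with difference \<open>ord q 2\<close> the symbol at \<open>q\<close> is constant, while
  the symbol at \<open>p\<close> runs over an orbit.\<close>
lemma lsym_correlation:
  assumes p: "prime p" "2 < p" and q: "prime q" "p < q"
  shows "\<bar>\<Sum>m<N. lsym p (p * q * (m + 1)) * lsym q (p * q * (m + 1))\<bar>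
    \<le> real N * sqrt (real p) * real (gcd (ord p 2) (ord q 2)) / real (ord p 2) + real p * real q"
proof -
  define dp where "dp = ord p 2"
  define d where "d = ord q 2"
  define g where "g = gcd dp d"
  define T where "T = N div d"
  define G where "G m = lsym p (p * q * (m + 1)) * lsym q (p * q * (m + 1))" for m
  have q2: "2 < q" using p q by simp
  have d: "0 < d" "d < q" using ord_2_bounds[OF q(1) q2] by (auto simp: d_def)
  have dp: "0 < dp" "dp < p" using ord_2_bounds[OF p] by (auto simp: dp_def)
  have g: "g > 0" using dp by (simp add: g_def)
  have G1: "\<bar>G m\<bar> \<le> 1" for m
    using mult_mono[OF abs_lsym_le[of p] abs_lsym_le[of q]] by (simp add: G_def abs_mult)
  \<comment> \<open>Raising \<open>m\<close> by \<open>d\<close> raises n = p q (m + 1) by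
    \<open>p * q * d\<close>, so 2^(n+1) is multiplied by this \<open>z\<close>.\<close>
  define z where "z = (2::nat) ^ (p * q * d)"
  define D where "D = ord p z"
  have cz: "coprime p z" using coprime_2_prime[OF p] by (simp add: z_def)
  have D0: "D > 0" using cz by (simp add: D_def)
  \<comment> \<open>The order of \<open>z\<close> is \<open>dp\<close> divided by gcd(p q d, dp).
    The factor \<open>p * q\<close> does not enter this gcd, since 0 < \<open>dp\<close> < p <
    q.\<close>
  have Dg: "D * g = dp"
  proof -
    have "coprime p dp" "coprime q dp"
      using p q dp by (auto intro!: prime_imp_coprime simp: nat_dvd_not_less)
    then have "coprime dp (p * q)" by (simp add: coprime_commute)
    then have "gcd (p * q * d) dp = g"
      by (metis g_def gcd.commute gcd_mult_left_left_cancel)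
    with ord_power_aux[of p 2 "p * q * d"] show ?thesis
      by (simp add: D_def z_def dp_def)
  qed
  have D_eq: "real D = real dp / real g" using Dg g by (simp add: field_simps flip: of_nat_mult)
  have D_le: "D \<le> dp" using Dg g by (metis dvd_imp_le dvd_triv_left dp(1))
  have inner: "\<bar>\<Sum>t<T. G (t * d + r)\<bar> \<le> real T / real D * sqrt (real p) + real D" for r
  proof -
    define F where "F t = lsym p (p * q * (t * d + r + 1))" for t
    define w where "w = (2::nat) ^ (p * q * (r + 1) + 1)"
    have F_eq: "F t = real_of_int (chi p (int w * int z ^ t - 1))" for t
      by (simp add: F_def lsym_def w_def z_def algebra_simps flip: power_mult power_add)
    have cw: "coprime w p"
      using coprime_2_prime[OF p] by (simp add: w_def coprime_commute)
    have "(\<Sum>t<D. chi p (int w * int z ^ t - 1))\<^sup>2 \<le> int p"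
      unfolding D_def by (rule charsum_orbit_bound[OF p cw cz])
    then have "real_of_int ((\<Sum>t<D. chi p (int w * int z ^ t - 1))\<^sup>2) \<le> real_of_int (int p)"
      by (simp only: of_int_le_iff)
    then have "(\<Sum>t<D. F t)\<^sup>2 \<le> real p"
      by (simp add: F_eq)
    then have "\<bar>\<Sum>t<D. F t\<bar> \<le> sqrt (real p)"
      by (simp add: real_le_rsqrt)
    moreover have "F (t + D) = F t" for t
    proof -
      have "[int (z ^ D) = int 1] (mod int p)"
        using ord[of z p] unfolding cong_int_iff D_def .
      then have "[int w * int z ^ t * int z ^ D = int w * int z ^ t * 1] (mod int p)"
        by (intro cong_mult cong_refl) simp
      then have "[int w * int z ^ (t + D) - 1 = int w * int z ^ t - 1] (mod int p)"
        by (intro cong_diff cong_refl) (simp add: power_add mult.assoc)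
      then show ?thesis by (simp add: F_eq chi_cong)
    qed
    ultimately have F_le: "\<bar>\<Sum>t<T. F t\<bar> \<le> real T / real D * sqrt (real p) + real D"
      using D0 by (intro abs_sum_periodic_le) (auto simp: F_def abs_lsym_le)
    have "G (t * d + r) = lsym q (p * q * (r + 1)) * F t" for t
    proof -
      have "[p * q * (t * d + r + 1) = p * q * (r + 1)] (mod d)"
      proof -
        have "p * q * (t * d + r + 1) = p * q * (r + 1) + (p * q * t) * d"
          by (simp add: algebra_simps)
        then show ?thesis
          by (simp only: unique_euclidean_semiring_class.cong_def mod_mult_self1)
      qed
      then have "lsym q (p * q * (t * d + r + 1)) = lsym q (p * q * (r + 1))"
        using lsym_cong[OF q(1) q2] by (simp add: d_def)
      then show ?thesis by (simp add: G_def F_def)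
    qed
    then have "\<bar>\<Sum>t<T. G (t * d + r)\<bar> = \<bar>lsym q (p * q * (r + 1))\<bar> * \<bar>\<Sum>t<T. F t\<bar>"
      by (simp add: abs_mult flip: sum_distrib_left)
    also have "\<dots> \<le> 1 * \<bar>\<Sum>t<T. F t\<bar>"
      by (intro mult_right_mono abs_lsym_le) simp
    finally show ?thesis using F_le by linarith
  qed
  \<comment> \<open>The first \<open>T * d\<close> terms are sorted by their residue modulo
    \<open>d\<close>, so that \<open>inner\<close> applies to each class; fewer than
    \<open>d\<close> terms are left over.\<close>
  have "(\<Sum>m<T * d. G m) = (\<Sum>t<T. \<Sum>m\<in>{t * d..<t * d + d}. G m)"
    by (rule sum.nat_group[symmetric])
  also have "\<dots> = (\<Sum>t<T. \<Sum>r<d. G (t * d + r))"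
  proof (rule sum.cong[OF refl])
    fix t
    show "(\<Sum>m\<in>{t * d..<t * d + d}. G m) = (\<Sum>r<d. G (t * d + r))"
      using sum.shift_bounds_nat_ivl[of G 0 "t * d" d] by (simp add: lessThan_atLeast0 add.commute)
  qed
  also have "\<dots> = (\<Sum>r<d. \<Sum>t<T. G (t * d + r))" by (rule sum.swap)
  finally have "\<bar>\<Sum>m<T * d. G m\<bar> \<le> (\<Sum>r<d. \<bar>\<Sum>t<T. G (t * d + r)\<bar>)"
    by (simp add: sum_abs)
  also have "\<dots> \<le> (\<Sum>r<d. real T / real D * sqrt (real p) + real D)"
    by (intro sum_mono inner)
  also have "\<dots> = real (T * d) / real D * sqrt (real p) + real d * real D"
    by (simp add: algebra_simps)
  also have "\<dots> \<le> real N / real D * sqrt (real p) + real d * real dp"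
  proof -
    have "real (T * d) \<le> real N"
      by (simp only: of_nat_le_iff T_def) simp
    then show ?thesis
      using D0 D_le by (intro add_mono mult_right_mono mult_left_mono divide_right_mono) auto
  qed
  finally have main: "\<bar>\<Sum>m<T * d. G m\<bar> \<le> real N / real D * sqrt (real p) + real d * real dp" .
  have TN: "T * d \<le> N" "N < T * d + d"
    using d div_mult_mod_eq[of N d] mod_less_divisor[of d N] unfolding T_def by linarith+
  have "(\<Sum>m<N. G m) = (\<Sum>m<T * d. G m) + (\<Sum>m\<in>{T * d..<N}. G m)"
    using TN(1) by (metis (no_types) lessThan_atLeast0 sum.atLeastLessThan_concat zero_le)
  moreover have "\<bar>\<Sum>m\<in>{T * d..<N}. G m\<bar> \<le> real d"
  proof -
    have "\<bar>\<Sum>m\<in>{T * d..<N}. G m\<bar> \<le> (\<Sum>m\<in>{T * d..<N}. \<bar>G m\<bar>)" by (rule sum_abs)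
    also have "\<dots> \<le> (\<Sum>m\<in>{T * d..<N}. 1)" by (intro sum_mono G1)
    also have "\<dots> = real (N - T * d)" by simp
    also have "\<dots> \<le> real d" using TN by (intro of_nat_mono) linarith
    finally show ?thesis .
  qed
  \<comment> \<open>The incomplete orbits in the \<open>d\<close> classes cost at most
    \<open>d * dp\<close>, the leftover terms at most \<open>d\<close>.\<close>
  moreover have "real d * real dp + real d \<le> real p * real q"
  proof -
    have "real d * real dp + real d = real d * (real dp + 1)" by (simp add: algebra_simps)
    also have "\<dots> \<le> real q * real p" using d dp by (intro mult_mono) auto
    finally show ?thesis by (simp add: mult.commute)
  qed
  moreover have "real N / real D * sqrt (real p) = real N * sqrt (real p) * real g / real dp"
    using D_eq g dp by simp
  ultimately have "\<bar>\<Sum>m<N. G m\<bar> \<le> real N * sqrt (real p) * real g / real dp + real p * real q"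
    using main by linarith
  then show ?thesis by (simp add: G_def g_def d_def dp_def)
qed

subsection \<open>Powers of two minus one that are powers of two\<close>

text \<open>For \<open>a = n + 1\<close> this is what membership of n in \<open>setC\<close> implies
  at a prime factor \<open>p\<close> once the exponent may depend on \<open>p\<close>; it is a local
  condition on \<open>a\<close> modulo \<open>ord p 2\<close>.\<close>

definition hits_pow2 :: "nat \<Rightarrow> nat \<Rightarrow> bool" where
  "hits_pow2 p a \<longleftrightarrow> (\<exists>b::nat. [(2::int) ^ a - 1 = 2 ^ b] (mod int p))"

text \<open>Since \<open>k = 0\<close> is allowed, this includes the prime divisors of \<open>2 ^ k - 1\<close> for \<open>0 < k \<le> W\<close>.\<close>
definition exceptional :: "nat \<Rightarrow> nat \<Rightarrow> bool" where
  "exceptional W p \<longleftrightarrow>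
    (\<exists>k k' i. k < k' \<and> k' \<le> W \<and> [(2::int) ^ k' - 1 = 2 ^ i * (2 ^ k - 1)] (mod int p))"

lemma pow2_cong_iff:
  assumes "prime p" "2 < p"
  shows "[(2::int) ^ a = 2 ^ b] (mod int p) \<longleftrightarrow> [a = b] (mod ord p 2)"
proof -
  have "[(2::int) ^ a = 2 ^ b] (mod int p) \<longleftrightarrow> [int (2 ^ a) = int (2 ^ b)] (mod int p)"
    by simp
  also have "\<dots> \<longleftrightarrow> [(2::nat) ^ a = 2 ^ b] (mod p)"
    by (simp only: cong_int_iff)
  also have "\<dots> \<longleftrightarrow> [a = b] (mod ord p 2)"
    by (rule order_divides_expdiff[OF coprime_2_prime[OF assms]])
  finally show ?thesis .
qed

lemma pow2_quotient:
  assumes p: "prime p" "2 < p"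
  obtains e where "e < ord p 2" "[(2::int) ^ e * 2 ^ s = 2 ^ t] (mod int p)"
proof -
  define d where "d = ord p 2"
  have d: "d > 0" using ord_2_bounds[OF p] by (simp add: d_def)
  \<comment> \<open>Modulo \<open>d\<close>, the natural number \<open>(d - 1) * s\<close> stands
    for -s.\<close>
  define e where "e = (t + (d - 1) * s) mod d"
  have "[e + s = t + (d - 1) * s + s] (mod d)"
    by (intro cong_add cong_refl) (simp add: e_def unique_euclidean_semiring_class.cong_def)
  also have "t + (d - 1) * s + s = t + s * d"
    using d by (cases d) (simp_all add: algebra_simps)
  also have "[t + s * d = t] (mod d)"
    by (simp add: unique_euclidean_semiring_class.cong_def)
  finally have "[(2::int) ^ (e + s) = 2 ^ t] (mod int p)"
    using pow2_cong_iff[OF p] by (simp add: d_def)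
  moreover have "e < d" using d by (simp add: e_def)
  ultimately show ?thesis by (intro that[of e]) (simp_all add: d_def power_add)
qed

lemma hits_pow2_cong:
  assumes "prime p" "2 < p" "[a = a'] (mod ord p 2)"
  shows "hits_pow2 p a \<longleftrightarrow> hits_pow2 p a'"
proof -
  have "[(2::int) ^ a - 1 = 2 ^ a' - 1] (mod int p)"
    using assms pow2_cong_iff by (intro cong_diff cong_refl) blast
  then show ?thesis unfolding hits_pow2_def by (meson cong_sym cong_trans)
qed

text \<open>If \<open>2 ^ a - 1\<close> and \<open>2 ^ (a + k) - 1\<close> are both powers of \<open>2\<close>, then so is their quotient
  divided by \<open>2 ^ k\<close>, say \<open>2 ^ e\<close>; this makes \<open>2 ^ k - 1\<close> a power of \<open>2\<close> times \<open>2 ^ e - 1\<close>.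
  For a non-exceptional \<open>p\<close> the exponent \<open>e\<close> therefore determines \<open>k\<close>, and then \<open>a\<close>.\<close>
lemma sum_correlations_hits_pow2:
  assumes p: "prime p" "2 < p" and W: "\<not> exceptional W p"
  shows "(\<Sum>k\<in>{1..W}. card {a. a < ord p 2 \<and> hits_pow2 p a \<and> hits_pow2 p (a + k)}) \<le> ord p 2"
proof -
  define d where "d = ord p 2"
  define A where "A k = {a. a < d \<and> hits_pow2 p a \<and> hits_pow2 p (a + k)}" for k
  have fin: "finite (A k)" for k by (simp add: A_def)
  have c2: "coprime (2 ^ s) (int p)" for s
    using p prime_odd_nat[of p] by simp
  have "\<exists>e b. e < d \<and> [2 ^ a - 1 = 2 ^ b] (mod int p) \<and>
      [(2 ^ e - 1) * 2 ^ (k + b) = (2::int) ^ k - 1] (mod int p)"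
    if "a \<in> A k" for k a
  proof -
    from that obtain b b' where b: "[(2::int) ^ a - 1 = 2 ^ b] (mod int p)"
      and b': "[(2::int) ^ (a + k) - 1 = 2 ^ b'] (mod int p)"
      by (auto simp: A_def hits_pow2_def)
    obtain e where e: "e < d" "[(2::int) ^ e * 2 ^ (k + b) = 2 ^ b'] (mod int p)"
      using pow2_quotient[OF p] unfolding d_def by blast
    have "(2 ^ e - 1) * 2 ^ (k + b) = (2::int) ^ e * 2 ^ (k + b) - 2 ^ k * 2 ^ b"
      by (simp add: power_add algebra_simps)
    also have "[\<dots> = (2 ^ (a + k) - 1) - 2 ^ k * (2 ^ a - 1)] (mod int p)"
      using b b' e by (intro cong_diff cong_mult cong_refl) (meson cong_sym cong_trans)+
    also have "(2 ^ (a + k) - 1) - 2 ^ k * (2 ^ a - 1) = (2::int) ^ k - 1"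
      by (simp add: power_add algebra_simps)
    finally show ?thesis using e b by blast
  qed
  then have "\<forall>k a. \<exists>e b. a \<in> A k \<longrightarrow> e < d \<and> [2 ^ a - 1 = 2 ^ b] (mod int p) \<and>
      [(2 ^ e - 1) * 2 ^ (k + b) = (2::int) ^ k - 1] (mod int p)"
    by blast
  then obtain e b where eb: "\<And>k a. a \<in> A k \<Longrightarrow> e k a < d"
    "\<And>k a. a \<in> A k \<Longrightarrow> [2 ^ a - 1 = 2 ^ b k a] (mod int p)"
    "\<And>k a. a \<in> A k \<Longrightarrow> [(2 ^ e k a - 1) * 2 ^ (k + b k a) = (2::int) ^ k - 1] (mod int p)"
    by metis
  have key: "[2 ^ k' - 1 = 2 ^ i * (2 ^ k - 1)] (mod int p)"
    if "a \<in> A k" "a' \<in> A k'" "e k a = e k' a'" "[(2::int) ^ i * 2 ^ (k + b k a) = 2 ^ (k' + b k' a')] (mod int p)"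
    for k a k' a' i
  proof -
    have "[2 ^ k' - 1 = (2 ^ e k' a' - 1) * (2::int) ^ (k' + b k' a')] (mod int p)"
      using eb(3)[OF that(2)] by (rule cong_sym)
    also have "[(2 ^ e k' a' - 1) * (2::int) ^ (k' + b k' a')
        = (2 ^ e k a - 1) * (2 ^ i * 2 ^ (k + b k a))] (mod int p)"
      unfolding that(3) by (intro cong_mult cong_refl cong_sym[OF that(4)])
    also have "(2 ^ e k a - 1) * (2 ^ i * 2 ^ (k + b k a)) = 2 ^ i * ((2 ^ e k a - 1) * (2::int) ^ (k + b k a))"
      by (simp add: algebra_simps)
    also have "[\<dots> = 2 ^ i * (2 ^ k - 1)] (mod int p)"
      by (intro cong_mult cong_refl eb(3) that)
    finally show ?thesis .
  qed
  have not_less: False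
    if "a \<in> A k" "a' \<in> A k'" "e k a = e k' a'" "k < k'" "k' \<le> W" for k a k' a'
  proof -
    obtain i where "[(2::int) ^ i * 2 ^ (k + b k a) = 2 ^ (k' + b k' a')] (mod int p)"
      using pow2_quotient[OF p] by blast
    from key[OF that(1-3) this] that(4,5) W show False
      unfolding exceptional_def by blast
  qed
  have "inj_on (\<lambda>(k, a). e k a) (SIGMA k:{1..W}. A k)"
  proof (rule inj_onI, clarify)
    fix k a k' a'
    assume *: "k \<in> {1..W}" "a \<in> A k" "k' \<in> {1..W}" "a' \<in> A k'" "e k a = e k' a'"
    then have k: "k' = k"
      using not_less[of a k a' k'] not_less[of a' k' a k] by (metis atLeastAtMost_iff nat_neq_iff)
    \<comment> \<open>The instance of \<open>exceptional\<close> with smaller exponent 0 shows that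
      \<open>p\<close> does not divide 2^k - 1. Hence 2^e - 1 is invertible modulo \<open>p\<close>
      as well and can be cancelled below.\<close>
    have "\<not> [(2::int) ^ k - 1 = 2 ^ 0 * (2 ^ 0 - 1)] (mod int p)"
      using W *(1) unfolding exceptional_def by (metis One_nat_def Suc_le_lessD atLeastAtMost_iff)
    then have nd: "\<not> int p dvd 2 ^ k - 1" by (simp add: cong_0_iff)
    have eq: "[(2 ^ e k a - 1) * 2 ^ (k + b k a) = (2 ^ e k a - 1) * (2::int) ^ (k + b k a')] (mod int p)"
      using eb(3)[OF *(2)] eb(3)[OF *(4)] *(5) unfolding k by (metis cong_sym cong_trans)
    have "\<not> int p dvd 2 ^ e k a - 1"
      using nd eb(3)[OF *(2)] by (metis cong_dvd_iff dvd_mult2)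
    then have "[(2::int) ^ (k + b k a) = 2 ^ (k + b k a')] (mod int p)"
      using eq coprime_of_not_dvd[OF p(1)] by (simp add: cong_mult_lcancel)
    then have "[2 ^ k * (2::int) ^ b k a = 2 ^ k * 2 ^ b k a'] (mod int p)"
      by (simp add: power_add)
    then have "[(2::int) ^ b k a = 2 ^ b k a'] (mod int p)"
      using c2 by (simp add: cong_mult_lcancel)
    then have "[(2::int) ^ a - 1 = 2 ^ a' - 1] (mod int p)"
      using eb(2)[OF *(2)] eb(2)[OF *(4)] unfolding k by (metis cong_sym cong_trans)
    then have "[(2::int) ^ a = 2 ^ a'] (mod int p)"
      by (simp add: cong_iff_dvd_diff)
    then have "[a = a'] (mod d)"
      using pow2_cong_iff[OF p] by (simp add: d_def)
    then have "a = a'"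
      using *(2,4) by (simp add: A_def cong_less_modulus_unique_nat)
    with k show "k = k' \<and> a = a'" by simp
  qed
  then have "card (SIGMA k:{1..W}. A k) \<le> card {..<d}"
    by (rule card_inj_on_le) (use eb(1) in auto)
  then show ?thesis
    by (simp add: fin card_SigmaI A_def d_def)
qed

lemma sum_periodic_shift_by:
  fixes F :: "nat \<Rightarrow> real"
  assumes "\<And>t. F (t + D) = F t"
  shows "(\<Sum>t<D. F (t + k)) = (\<Sum>t<D. F t)"
proof (induction k)
  case (Suc k)
  have "(\<Sum>t<D. F (Suc t + k)) = (\<Sum>t<D. F (t + k))"
    by (rule sum_periodic_shift[of "\<lambda>t. F (t + k)"]) (use assms[of k] in \<open>simp add: add.commute\<close>)
  with Suc.IH show ?case by simp
qed simp

text \<open>Let b be the number of hits in a period d. Each hit lies in \<open>W\<close> windows of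
  length \<open>W\<close>, so W b is the sum of the hit counts of all d windows. Cauchy-Schwarz
  bounds its square by d times a sum of correlations over pairs \<open>k\<close>, \<open>l\<close> <
  \<open>W\<close>. For fixed \<open>k\<close> the terms with \<open>l\<close> < \<open>k\<close>,
  \<open>l\<close> = \<open>k\<close> and \<open>l\<close> > \<open>k\<close> contribute at most d
  each, by \<open>sum_correlations_hits_pow2\<close>; this is the constant 3.\<close>

lemma density_hits_pow2:
  assumes p: "prime p" "2 < p" and W: "\<not> exceptional W p"
  shows "real W * (real (card {a. a < ord p 2 \<and> hits_pow2 p a}))\<^sup>2 \<le> 3 * (real (ord p 2))\<^sup>2"
proof (cases "W = 0")
  case False
  define d where "d = ord p 2"
  define f where "f a = (if hits_pow2 p a then 1 else 0 :: real)" for a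
  define b where "b = real (card {a. a < d \<and> hits_pow2 p a})"
  define R where "R k = (\<Sum>a<d. f a * f (a + k))" for k
  have d: "d > 0" using ord_2_bounds[OF p] by (simp add: d_def)
  have f_per: "f (a + d) = f a" for a
  proof -
    have "[a + d = a] (mod d)" by (simp add: unique_euclidean_semiring_class.cong_def)
    then show ?thesis using hits_pow2_cong[OF p] by (simp add: f_def d_def)
  qed
  have R_nonneg: "R k \<ge> 0" for k unfolding R_def by (intro sum_nonneg) (simp add: f_def)
  have b_eq: "(\<Sum>a<d. f a) = b"
    by (simp add: f_def b_def sum.If_cases Int_def lessThan_def)
  have b_le: "b \<le> real d"
    using card_mono[of "{..<d}" "{a. a < d \<and> hits_pow2 p a}"] by (auto simp: b_def)
  have R0: "R 0 = b"
    unfolding R_def b_eq[symmetric] by (intro sum.cong refl) (simp add: f_def)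
  have R_card: "R k = real (card {a. a < d \<and> hits_pow2 p a \<and> hits_pow2 p (a + k)})" for k
  proof -
    have "R k = (\<Sum>a<d. if hits_pow2 p a \<and> hits_pow2 p (a + k) then 1 else 0)"
      unfolding R_def by (intro sum.cong refl) (simp add: f_def)
    then show ?thesis by (simp add: sum.If_cases Int_def lessThan_def)
  qed
  have R_sum: "(\<Sum>k\<in>{1..W}. R k) \<le> real d"
    using sum_correlations_hits_pow2[OF p W] unfolding R_card d_def
    by (simp flip: of_nat_sum)
  have R_shift: "(\<Sum>a<d. f (a + k) * f (a + l)) = R (l - k)" if "k \<le> l" for k l
  proof -
    have "R (l - k) = (\<Sum>a<d. (\<lambda>a. f a * f (a + (l - k))) (a + k))"
      unfolding R_def
      by (rule sum_periodic_shift_by[symmetric]) (metis add.assoc add.commute f_per)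
    with that show ?thesis by (simp add: add.assoc)
  qed
  have inner: "(\<Sum>l<W. \<Sum>a<d. f (a + k) * f (a + l)) \<le> 3 * real d" if k: "k < W" for k
  proof -
    have upper: "(\<Sum>l\<in>{k<..<W}. R (l - k)) \<le> (\<Sum>k\<in>{1..W}. R k)"
    proof -
      have "(\<Sum>l\<in>{k<..<W}. R (l - k)) = (\<Sum>j\<in>(\<lambda>l. l - k) ` {k<..<W}. R j)"
        by (subst sum.reindex) (auto simp: inj_on_def)
      also have "\<dots> \<le> (\<Sum>j\<in>{1..W}. R j)"
        by (intro sum_mono2 R_nonneg) auto
      finally show ?thesis .
    qed
    have lower: "(\<Sum>l\<in>{..<k}. R (k - l)) \<le> (\<Sum>k\<in>{1..W}. R k)"
    proof -
      have "(\<Sum>l\<in>{..<k}. R (k - l)) = (\<Sum>j\<in>(\<lambda>l. k - l) ` {..<k}. R j)"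
        by (subst sum.reindex) (auto simp: inj_on_def)
      also have "\<dots> \<le> (\<Sum>j\<in>{1..W}. R j)"
        using k by (intro sum_mono2 R_nonneg) auto
      finally show ?thesis .
    qed
    have split: "sum H {..<W} = sum H {..<k} + (H k + sum H {k<..<W})" for H :: "nat \<Rightarrow> real"
    proof -
      have "{..<W} = {..<k} \<union> insert k {k<..<W}" using k by auto
      then have "sum H {..<W} = sum H ({..<k} \<union> insert k {k<..<W})" by simp
      also have "\<dots> = sum H {..<k} + sum H (insert k {k<..<W})"
        by (rule sum.union_disjoint) auto
      finally show ?thesis by simp
    qed
    have "(\<Sum>l<W. \<Sum>a<d. f (a + k) * f (a + l))
        = (\<Sum>l<k. \<Sum>a<d. f (a + k) * f (a + l)) + ((\<Sum>a<d. f (a + k) * f (a + k))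
          + (\<Sum>l\<in>{k<..<W}. \<Sum>a<d. f (a + k) * f (a + l)))"
      by (rule split)
    also have "(\<Sum>l<k. \<Sum>a<d. f (a + k) * f (a + l)) = (\<Sum>l<k. R (k - l))"
      by (intro sum.cong refl) (simp add: R_shift[symmetric] mult.commute)
    also have "(\<Sum>l\<in>{k<..<W}. \<Sum>a<d. f (a + k) * f (a + l)) = (\<Sum>l\<in>{k<..<W}. R (l - k))"
      by (intro sum.cong refl R_shift) auto
    also have "(\<Sum>a<d. f (a + k) * f (a + k)) = b"
      using R_shift[of k k] R0 by simp
    finally show ?thesis using upper lower R_sum b_le by linarith
  qed
  have "(real W * b)\<^sup>2 = (\<Sum>a<d. \<Sum>k<W. f (a + k))\<^sup>2"
    by (subst sum.swap) (simp add: sum_periodic_shift_by[of f d, OF f_per] b_eq)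
  also have "\<dots> \<le> real d * (\<Sum>a<d. (\<Sum>k<W. f (a + k))\<^sup>2)"
    using sum_squared_le_sum_of_squares[of "\<lambda>a. \<Sum>k<W. f (a + k)" "{..<d}"] by (simp add: mult.commute)
  also have "(\<Sum>a<d. (\<Sum>k<W. f (a + k))\<^sup>2) = (\<Sum>k<W. \<Sum>l<W. \<Sum>a<d. f (a + k) * f (a + l))"
    unfolding power2_eq_square sum_product
    by (subst sum.swap, rule sum.cong[OF refl], rule sum.swap)
  also have "\<dots> \<le> (\<Sum>k<W. 3 * real d)"
    by (intro sum_mono inner) simp
  finally have "(real W * b)\<^sup>2 \<le> real d * (real W * (3 * real d))"
    using d by simp
  then have "real W * (real W * b\<^sup>2) \<le> real W * (3 * (real d)\<^sup>2)"
    by (simp add: power2_eq_square algebra_simps)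
  with False show ?thesis by (simp add: b_def d_def)
qed simp

lemma sum_multiples:
  fixes F :: "nat \<Rightarrow> real"
  assumes "a > 0"
  shows "(\<Sum>n\<in>{1..N}. if a dvd n then F n else 0) = (\<Sum>m<N div a. F (a * (m + 1)))"
proof -
  have "(\<Sum>n\<in>{1..N}. if a dvd n then F n else 0) = sum F {n \<in> {1..N}. a dvd n}"
    by (rule sum.inter_filter[symmetric]) simp
  also have "{n \<in> {1..N}. a dvd n} = (\<lambda>m. a * (m + 1)) ` {..<N div a}"
  proof (intro equalityI subsetI)
    fix n assume n: "n \<in> {n \<in> {1..N}. a dvd n}"
    then obtain m where m: "n = a * m" by auto
    with n have "m \<ge> 1" by (cases m) auto
    moreover have "m \<le> N div a" using n m assms by (simp add: less_eq_div_iff_mult_less_eq mult.commute)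
    ultimately show "n \<in> (\<lambda>m. a * (m + 1)) ` {..<N div a}"
      using m by (intro image_eqI[of _ _ "m - 1"]) auto
  next
    fix n assume "n \<in> (\<lambda>m. a * (m + 1)) ` {..<N div a}"
    then obtain m where m: "n = a * (m + 1)" "m < N div a" by auto
    then have "Suc m \<le> N div a" by simp
    then have "a * (m + 1) \<le> N"
      using assms by (simp add: less_eq_div_iff_mult_less_eq mult.commute)
    with m assms show "n \<in> {n \<in> {1..N}. a dvd n}" by auto
  qed
  also have "sum F \<dots> = (\<Sum>m<N div a. F (a * (m + 1)))"
    using assms by (subst sum.reindex) (auto simp: inj_on_def)
  finally show ?thesis .
qed

text \<open>Since p = 1 modulo \<open>ord p 2\<close>, the multiples of \<open>p\<close> run through
  the residues modulo \<open>ord p 2\<close> exactly as consecutive integers do. The density over a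
  period therefore carries over, up to one incomplete period.\<close>

lemma card_multiples_hits_pow2:
  assumes p: "prime p" "2 < p"
  shows "real (card {n \<in> {1..N}. p dvd n \<and> hits_pow2 p (n + 1)})
    \<le> real N / real p * (real (card {a. a < ord p 2 \<and> hits_pow2 p a}) / real (ord p 2)) + real p"
proof -
  define d where "d = ord p 2"
  define b where "b = real (card {a. a < d \<and> hits_pow2 p a})"
  define f where "f a = (if hits_pow2 p a then 1 else 0 :: real)" for a
  have d: "0 < d" "d < p" using ord_2_bounds[OF p] by (auto simp: d_def)
  have f_per: "f (a + d) = f a" for a
  proof -
    have "[a + d = a] (mod d)" by (simp add: unique_euclidean_semiring_class.cong_def)
    then show ?thesis using hits_pow2_cong[OF p] by (simp add: f_def d_def)
  qed
  have b_eq: "(\<Sum>a<d. f a) = b"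
    by (simp add: f_def b_def sum.If_cases Int_def lessThan_def)
  have hits_iff: "hits_pow2 p (p * m + 1) \<longleftrightarrow> hits_pow2 p (m + 1)" for m
  proof (rule hits_pow2_cong[OF p])
    have "[p = 1] (mod d)"
      using ord_dvd_prime_minus_1[OF p] p by (simp add: cong_altdef_nat d_def)
    then have "[p * m + 1 = 1 * m + 1] (mod d)"
      by (intro cong_add cong_mult cong_refl)
    then show "[p * m + 1 = m + 1] (mod ord p 2)" by (simp add: d_def)
  qed
  let ?L = "{n \<in> {1..N}. p dvd n \<and> hits_pow2 p (n + 1)}"
  have "real (card ?L) = (\<Sum>n\<in>?L. 1)" by simp
  also have "\<dots> = (\<Sum>n\<in>{1..N}. if p dvd n \<and> hits_pow2 p (n + 1) then 1 else 0)"
    by (rule sum.inter_filter) simp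
  also have "\<dots> = (\<Sum>n\<in>{1..N}. if p dvd n then f (n + 1) else 0)"
    by (intro sum.cong refl) (simp add: f_def)
  also have "\<dots> = (\<Sum>m<N div p. f (p * (m + 1) + 1))"
    using p by (intro sum_multiples) simp
  \<comment> \<open>The multiple p (m + 1) is congruent to m + 1, and the exponent in question is
    one larger.\<close>
  also have "\<dots> = (\<Sum>m<N div p. f (m + 2))"
    by (intro sum.cong refl) (simp only: f_def hits_iff, simp)
  also have "\<dots> \<le> \<bar>\<Sum>m<N div p. f (m + 2)\<bar>" by simp
  also have "\<dots> \<le> real (N div p) / real d * b + real d"
  proof (rule abs_sum_periodic_le[OF d(1)])
    show "f (t + d + 2) = f (t + 2)" for t using f_per[of "t + 2"] by (simp add: add.commute add.left_commute)
    show "\<bar>f (t + 2)\<bar> \<le> 1" for t by (simp add: f_def)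
    show "\<bar>\<Sum>t<d. f (t + 2)\<bar> \<le> b"
      using sum_periodic_shift_by[of f d 2, OF f_per] b_eq by (simp add: b_def)
  qed
  also have "\<dots> \<le> real N / real p / real d * b + real p"
    using d of_nat_div_le_of_nat[of N p, where ?'a = real]
    by (intro add_mono mult_right_mono divide_right_mono) (auto simp: b_def)
  finally show ?thesis by (simp add: b_def d_def)
qed

subsection \<open>Exceptional primes\<close>

lemma prod_primes_dvd:
  fixes n :: nat
  assumes "finite Q" "\<And>p. p \<in> Q \<Longrightarrow> prime p" "\<And>p. p \<in> Q \<Longrightarrow> p dvd n"
  shows "\<Prod>Q dvd n"
  using assms
proof (induction Q rule: finite_induct)
  case (insert p Q)
  have "coprime p (\<Prod>Q)"
    by (rule prod_coprime_right) (metis insert.hyps(2) insert.prems(1) insertCI primes_coprime)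
  then have "p * \<Prod>Q dvd n"
    using insert by (intro divides_mult) auto
  with insert.hyps show ?case by simp
qed simp

lemma two_power_card_primes_le:
  fixes n :: nat
  assumes "finite Q" "\<And>p. p \<in> Q \<Longrightarrow> prime p" "\<And>p. p \<in> Q \<Longrightarrow> p dvd n" "n > 0"
  shows "2 ^ card Q \<le> n"
proof -
  have "2 ^ card Q = (\<Prod>p\<in>Q. 2 :: nat)" by simp
  also have "\<dots> \<le> \<Prod>Q"
    by (rule prod_mono) (use assms(2) prime_ge_2_nat in auto)
  also have "\<dots> \<le> n"
    using prod_primes_dvd[OF assms(1-3)] assms(4) by (intro dvd_imp_le) auto
  finally show ?thesis .
qed

text \<open>This is the multiplicative independence used for exceptional primes. For
  \<open>k\<close> > 0 the Mersenne factors are odd, so comparing powers of 2 forces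
  \<open>s = s'\<close>, and then monotonicity in \<open>k\<close> decides. For \<open>k\<close> = 0
  and \<open>e\<close> > 0 the right side vanishes and the left does not.\<close>

lemma two_power_mult_mersenne_power_neq:
  fixes k k' s s' e :: nat
  assumes "k < k'" "e > 0 \<or> s \<noteq> s'"
  shows "(2::int) ^ s * (2 ^ k' - 1) ^ e \<noteq> 2 ^ s' * (2 ^ k - 1) ^ e"
proof
  assume eq: "(2::int) ^ s * (2 ^ k' - 1) ^ e = 2 ^ s' * (2 ^ k - 1) ^ e"
  have lt: "(2::int) ^ k < 2 ^ k'" using assms(1) by simp
  show False
  proof (cases "e = 0")
    case True
    with eq assms(2) show False by simp
  next
    case False
    have v: "(2::int) ^ k' - 1 > 0" using lt by (smt (verit) one_le_power)
    show False
    proof (cases "k = 0")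
      case True
      with eq False have "(2::int) ^ s * (2 ^ k' - 1) ^ e = 0" by (simp add: zero_power)
      with v show False by simp
    next
      case k: False
      have odd: "odd (((2::int) ^ j - 1) ^ e)" if "j > 0" for j using that by simp
      have le: "s \<le> s'" if "(2::int) ^ s * x = 2 ^ s' * y" "odd y" "odd x" for s s' x y
      proof (rule ccontr)
        assume "\<not> s \<le> s'"
        then have "s = s' + Suc (s - s' - 1)" by simp
        then obtain r where r: "s = s' + Suc r" ..
        have "2 ^ s' * (2 * (2 ^ r * x)) = 2 ^ s' * y"
          using that(1) unfolding r power_add by simp
        then have "2 * (2 ^ r * x) = y" by simp
        with that(2) show False by (metis dvd_triv_left)
      qed
      have "s = s'"
        using le[OF eq] le[OF eq[symmetric]] odd[of k] odd[of k'] k assms(1) by simp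
      with eq have "((2::int) ^ k' - 1) ^ e = (2 ^ k - 1) ^ e" by simp
      moreover have "((2::int) ^ k - 1) ^ e < (2 ^ k' - 1) ^ e"
        using lt False by (intro power_strict_mono) auto
      ultimately show False by simp
    qed
  qed
qed

text \<open>If \<open>2 ^ k' - 1\<close> is \<open>2 ^ i\<close> times \<open>2 ^ k - 1\<close> modulo \<open>p\<close>, then the \<open>J\<^sup>2\<close> products
  \<open>2 ^ s * (2 ^ i) ^ j\<close> lie in the group of order \<open>ord p 2\<close> generated by \<open>2\<close>, so two of them coincide.
  Dividing by the smaller of the two powers \<open>2 ^ s\<close> leaves only \<open>O(J\<^sup>2)\<close> possible relations,
  which gains a factor \<open>J\<close> in \<open>card_exceptional_le\<close>.\<close>
lemma exceptional_witness:
  assumes p: "prime p" "2 < p" and exc: "exceptional W p" and J: "ord p 2 < J\<^sup>2"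
  obtains k k' s s' e where "k < k'" "k' \<le> W" "s < J" "s' < J" "e < J" "s = 0 \<or> s' = 0"
    "e > 0 \<or> s \<noteq> s'" "int p dvd 2 ^ s * (2 ^ k' - 1) ^ e - 2 ^ s' * (2 ^ k - 1) ^ e"
proof -
  note witness = that
  from exc obtain k k' i where k: "k < k'" "k' \<le> W"
    and i: "[(2::int) ^ k' - 1 = 2 ^ i * (2 ^ k - 1)] (mod int p)"
    unfolding exceptional_def by blast
  define d where "d = ord p 2"
  have d: "d > 0" using ord_2_bounds[OF p] by (simp add: d_def)
  define h where "h = (\<lambda>(s, j). (s + i * j) mod d)"
  have "\<not> inj_on h ({..<J} \<times> {..<J})"
  proof
    assume "inj_on h ({..<J} \<times> {..<J})"
    then have "card ({..<J} \<times> {..<J}) \<le> card {..<d}"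
      by (rule card_inj_on_le) (use d in \<open>auto simp: h_def\<close>)
    with J show False by (simp add: d_def power2_eq_square)
  qed
  then obtain s j s' j' where sj: "s < J" "j < J" "s' < J" "j' < J" "(s, j) \<noteq> (s', j')"
    "[s + i * j = s' + i * j'] (mod d)"
    unfolding inj_on_def h_def by (auto simp: unique_euclidean_semiring_class.cong_def)
  have wlog: thesis
    if sj: "s < J" "j < J" "s' < J" "j' < J" "(s, j) \<noteq> (s', j')"
      "[s + i * j = s' + i * j'] (mod d)" "j' \<le> j" for s j s' j'
  proof -
    define e where "e = j - j'"
    define m where "m = min s s'"
    have "[(s - m) + i * e + (m + i * j') = (s' - m) + (m + i * j')] (mod d)"
    proof -
      have "i * j = i * e + i * j'"
        using sj(7) by (simp add: e_def flip: add_mult_distrib2)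
      then have "(s - m) + i * e + (m + i * j') = s + i * j"
        by (simp add: m_def)
      moreover have "(s' - m) + (m + i * j') = s' + i * j'"
        by (simp add: m_def)
      ultimately show ?thesis using sj(6) by simp
    qed
    then have "[(s - m) + i * e = s' - m] (mod d)"
      by (simp add: cong_add_rcancel_nat)
    then have "[(2::int) ^ (s - m + i * e) = 2 ^ (s' - m)] (mod int p)"
      using pow2_cong_iff[OF p] unfolding d_def by blast
    then have c: "[(2::int) ^ (s - m) * (2 ^ i) ^ e = 2 ^ (s' - m)] (mod int p)"
      by (simp only: power_add power_mult)
    have "[(2::int) ^ (s - m) * (2 ^ k' - 1) ^ e = 2 ^ (s - m) * (2 ^ i * (2 ^ k - 1)) ^ e] (mod int p)"
      by (intro cong_mult cong_pow cong_refl i)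
    also have "2 ^ (s - m) * (2 ^ i * (2 ^ k - 1)) ^ e = (2 ^ (s - m) * (2 ^ i) ^ e) * ((2::int) ^ k - 1) ^ e"
      by (simp add: power_mult_distrib)
    also have "[\<dots> = 2 ^ (s' - m) * (2 ^ k - 1) ^ e] (mod int p)"
      by (intro cong_mult cong_refl c)
    finally have "int p dvd 2 ^ (s - m) * (2 ^ k' - 1) ^ e - 2 ^ (s' - m) * (2 ^ k - 1) ^ e"
      by (simp add: cong_iff_dvd_diff)
    \<comment> \<open>The two pairs differ, so if \<open>j = j'\<close> then \<open>s\<close> and
      \<open>s'\<close> differ: the relation is never trivial.\<close>
    moreover have "e > 0 \<or> s - m \<noteq> s' - m" using sj(5,7) by (auto simp: e_def m_def)
    ultimately show thesis
      using k sj by (intro witness[of k k' "s - m" "s' - m" e]) (auto simp: m_def e_def)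
  qed
  show thesis
  proof (cases "j' \<le> j")
    case True
    then show thesis using wlog[of s j s' j'] sj by blast
  next
    case False
    then show thesis using wlog[of s' j' s j] sj by (metis cong_sym nat_le_linear)
  qed
qed

text \<open>By \<open>exceptional_witness\<close> every such prime divides one of the nonzero
  integers \<open>Z x\<close>. There are (W + 1)^2 choices of \<open>k\<close>, \<open>k'\<close>,
  at most 2 J choices of \<open>s\<close>, \<open>s'\<close> because one of them is 0, and J choices
  of \<open>e\<close>. Each \<open>Z x\<close> has absolute value at most 2^(J (W + 1)), hence at
  most J (W + 1) prime factors.\<close>

lemma card_exceptional_le:
  assumes "finite Q"
    and Q: "\<And>p. p \<in> Q \<Longrightarrow> prime p \<and> 2 < p \<and> exceptional W p \<and> ord p 2 < J\<^sup>2"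
  shows "card Q \<le> 2 * (W + 1) ^ 3 * J ^ 3"
proof -
  define Z where "Z = (\<lambda>(k, k', s, s', e). (2::int) ^ s * (2 ^ k' - 1) ^ e - 2 ^ s' * (2 ^ k - 1) ^ e)"
  define S where "S = ({..<J} \<times> {0::nat}) \<union> ({0::nat} \<times> {..<J})"
  define I where "I = (\<lambda>((k, k'), (s, s'), e). (k, k', s, s', e)) ` (({..W} \<times> {..W}) \<times> S \<times> {..<J})"
  define I' where "I' = {x \<in> I. Z x \<noteq> 0}"
  have finS: "finite S" by (simp add: S_def)
  have finI: "finite I" by (simp add: I_def finS)
  then have finI': "finite I'" by (simp add: I'_def)
  have "card S \<le> J + J"
    unfolding S_def by (rule order.trans[OF card_Un_le]) (simp add: card_cartesian_product)
  then have "((W + 1) * (W + 1)) * (card S * J) \<le> ((W + 1) * (W + 1)) * ((J + J) * J)"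
    by (intro mult_left_mono mult_right_mono) auto
  then have "card ((({..W} \<times> {..W}) :: (nat \<times> nat) set) \<times> S \<times> {..<J}) \<le> ((W + 1) * (W + 1)) * ((J + J) * J)"
    by (simp only: card_cartesian_product card_atMost card_lessThan Suc_eq_plus1)
  then have cardI: "card I \<le> ((W + 1) * (W + 1)) * ((J + J) * J)"
    unfolding I_def by (rule order.trans[OF card_image_le, rotated]) (simp add: finS)
  have cover: "\<exists>x\<in>I'. int p dvd Z x" if "p \<in> Q" for p
  proof -
    from Q[OF that] have p: "prime p" "2 < p" "exceptional W p" "ord p 2 < J\<^sup>2" by auto
    obtain k k' s s' e where *: "k < k'" "k' \<le> W" "s < J" "s' < J" "e < J" "s = 0 \<or> s' = 0"
      "e > 0 \<or> s \<noteq> s'" "int p dvd 2 ^ s * (2 ^ k' - 1) ^ e - 2 ^ s' * (2 ^ k - 1) ^ e"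
      using exceptional_witness[OF p] by blast
    then have "Z (k, k', s, s', e) \<noteq> 0"
      using two_power_mult_mersenne_power_neq[of k k' e s s'] by (simp add: Z_def)
    moreover have "(k, k', s, s', e) \<in> I"
      unfolding I_def S_def using *
      by (intro image_eqI[of _ _ "((k, k'), (s, s'), e)"]) auto
    ultimately show ?thesis using * by (intro bexI[of _ "(k, k', s, s', e)"]) (auto simp: I'_def Z_def)
  qed
  have each: "card {p \<in> Q. int p dvd Z x} \<le> J * (W + 1)" if x: "x \<in> I'" for x
  proof -
    from x obtain k k' s s' e where x_eq: "x = (k, k', s, s', e)" and
      b: "k \<le> W" "k' \<le> W" "s < J" "s' < J" "e < J"
      by (auto simp: I'_def I_def S_def)
    have bound: "(0::int) \<le> 2 ^ s * (2 ^ k - 1) ^ e \<and> 2 ^ s * (2 ^ k - 1) ^ e \<le> (2::int) ^ (J * (W + 1))"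
      if "s < J" "k \<le> W" for s k :: nat
    proof
      have "(0::int) \<le> 2 ^ k - 1" by simp
      then show "(0::int) \<le> 2 ^ s * (2 ^ k - 1) ^ e" by simp
      have "((2::int) ^ k - 1) ^ e \<le> (2 ^ k) ^ e" by (intro power_mono) auto
      also have "\<dots> = 2 ^ (k * e)" by (simp add: power_mult)
      also have "\<dots> \<le> 2 ^ (W * J)" using that b by (intro power_increasing mult_mono) auto
      finally have "2 ^ s * ((2::int) ^ k - 1) ^ e \<le> 2 ^ J * 2 ^ (W * J)"
        using that by (intro mult_mono) auto
      then show "2 ^ s * ((2::int) ^ k - 1) ^ e \<le> 2 ^ (J * (W + 1))"
        by (simp add: algebra_simps flip: power_add)
    qed
    have abs_diff: "\<bar>u - v\<bar> \<le> m" if "0 \<le> u \<and> u \<le> m" "0 \<le> v \<and> v \<le> m" for u v m :: int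
      using that by linarith
    have "\<bar>Z x\<bar> \<le> 2 ^ (J * (W + 1))"
      unfolding Z_def x_eq prod.case by (intro abs_diff bound b)
    then have le: "nat \<bar>Z x\<bar> \<le> 2 ^ (J * (W + 1))"
      by (simp add: nat_le_iff)
    have "2 ^ card {p \<in> Q. int p dvd Z x} \<le> nat \<bar>Z x\<bar>"
    proof (rule two_power_card_primes_le)
      show "nat \<bar>Z x\<bar> > 0" using x by (simp add: I'_def)
    qed (use assms in \<open>auto simp: dvd_nat_abs_iff\<close>)
    with le have "(2::nat) ^ card {p \<in> Q. int p dvd Z x} \<le> 2 ^ (J * (W + 1))" by linarith
    then show ?thesis by (simp only: power_increasing_iff one_less_numeral_iff semiring_norm)
  qed
  have "Q \<subseteq> (\<Union>x\<in>I'. {p \<in> Q. int p dvd Z x})" using cover by blast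
  then have "card Q \<le> card (\<Union>x\<in>I'. {p \<in> Q. int p dvd Z x})"
    by (rule card_mono[rotated]) (use finI' assms(1) in auto)
  also have "\<dots> \<le> (\<Sum>x\<in>I'. card {p \<in> Q. int p dvd Z x})"
    by (rule card_UN_le[OF finI'])
  also have "\<dots> \<le> (\<Sum>x\<in>I'. J * (W + 1))" by (intro sum_mono each)
  also have "\<dots> = card I' * (J * (W + 1))" by simp
  also have "\<dots> \<le> (((W + 1) * (W + 1)) * ((J + J) * J)) * (J * (W + 1))"
    using card_mono[OF finI, of I'] cardI by (intro mult_mono) (auto simp: I'_def)
  also have "\<dots> = 2 * (W + 1) ^ 3 * J ^ 3"
    by (simp add: power3_eq_cube algebra_simps)
  finally show ?thesis .
qed

lemma sum_half_powers_le: "(\<Sum>j\<in>{a..<b}. (1/2::real) ^ j) \<le> 2 * (1/2) ^ a"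
proof (cases "a \<le> b")
  case True
  then have "(\<Sum>j\<in>{a..<b}. (1/2::real) ^ j) = 2 * (1/2) ^ a - 2 * (1/2) ^ b"
    by (induction b rule: dec_induct) simp_all
  then show ?thesis by simp
qed simp

text \<open>Split the primes into blocks from 2^(16 i) to 2^(16 (i + 1)). There the order is below
  2^(10 (i + 1)), so J = 2^(5 (i + 1)) is admissible and the block has at most 2^16 (W + 1)^3 2^(15
  i) exceptional primes. With 1/p at most 2^(-16 i) this leaves a geometric series, whose sum costs
  another factor 2.\<close>

lemma sum_inverse_exceptional_le:
  assumes "finite Q"
    and Q: "\<And>p. p \<in> Q \<Longrightarrow> prime p \<and> 2 < p \<and> exceptional W p \<and> ord p 2 ^ 8 < p ^ 5 \<and> 2 ^ (16 * a) \<le> p"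
  shows "(\<Sum>p\<in>Q. 1 / real p) \<le> 2 ^ 17 * (real W + 1) ^ 3 * (1/2) ^ a"
proof -
  have "\<forall>p. \<exists>j. p \<in> Q \<longrightarrow> (2 ^ 16) ^ j \<le> p \<and> p < (2 ^ 16) ^ (j + 1)"
    using ex_power_ivl1[of "2 ^ 16"] Q by (metis One_nat_def Suc_leI le_add_same_cancel1 one_add_one one_le_power prime_gt_0_nat self_le_power zero_less_numeral)
  then obtain j where j: "\<And>p. p \<in> Q \<Longrightarrow> (2 ^ 16) ^ j p \<le> p"
    "\<And>p. p \<in> Q \<Longrightarrow> p < (2 ^ 16) ^ (j p + 1)"
    by metis
  obtain b where b: "\<And>p. p \<in> Q \<Longrightarrow> j p < b"
    using assms(1) finite_nat_set_iff_bounded[of "j ` Q"] by auto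
  have a: "a \<le> j p" if "p \<in> Q" for p
  proof -
    have "(2 ^ 16) ^ a \<le> p" using Q[OF that] by (simp add: power_mult)
    also have "p < (2 ^ 16) ^ (j p + 1)" using j that by blast
    finally have "a < j p + 1" by (rule power_less_imp_less_exp[rotated]) simp
    then show ?thesis by simp
  qed
  have block: "(\<Sum>p\<in>{p \<in> Q. j p = i}. 1 / real p) \<le> 2 ^ 16 * (real W + 1) ^ 3 * (1/2) ^ i" for i
  proof -
    have "card {p \<in> Q. j p = i} \<le> 2 * (W + 1) ^ 3 * (2 ^ (5 * (i + 1))) ^ 3"
    proof (rule card_exceptional_le)
      fix p assume p: "p \<in> {p \<in> Q. j p = i}"
      then have "ord p 2 ^ 8 < p ^ 5" using Q by simp
      also have "p ^ 5 \<le> ((2 ^ 16) ^ (i + 1)) ^ 5"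
        using j p by (intro power_mono) (auto simp: less_imp_le)
      also have "((2 ^ 16) ^ (i + 1)) ^ 5 = ((2 ^ (5 * (i + 1)))\<^sup>2 :: nat) ^ 8"
        unfolding power_mult[symmetric] by (rule arg_cong[where f = "\<lambda>n. 2 ^ n"]) simp
      finally have "ord p 2 < (2 ^ (5 * (i + 1)))\<^sup>2"
        by (rule power_less_imp_less_base) simp
      with p Q show "prime p \<and> 2 < p \<and> exceptional W p \<and> ord p 2 < (2 ^ (5 * (i + 1)))\<^sup>2" by simp
    qed (use assms(1) in simp)
    then have card: "real (card {p \<in> Q. j p = i}) \<le> real (2 * (W + 1) ^ 3 * (2 ^ (5 * (i + 1))) ^ 3)"
      by (simp only: of_nat_le_iff)
    have "(\<Sum>p\<in>{p \<in> Q. j p = i}. 1 / real p) \<le> (\<Sum>p\<in>{p \<in> Q. j p = i}. 1 / (2 ^ 16) ^ i)"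
    proof (rule sum_mono)
      fix p assume p: "p \<in> {p \<in> Q. j p = i}"
      then have "real ((2 ^ 16) ^ i) \<le> real p" using j by (simp only: of_nat_le_iff mem_Collect_eq) blast
      then have "(2 ^ 16) ^ i \<le> real p" by simp
      then show "1 / real p \<le> 1 / (2 ^ 16) ^ i"
        by (intro divide_left_mono mult_pos_pos) (auto intro: less_le_trans[rotated])
    qed
    also have "\<dots> = real (card {p \<in> Q. j p = i}) / (2 ^ 16) ^ i" by simp
    also have "\<dots> \<le> real (2 * (W + 1) ^ 3 * (2 ^ (5 * (i + 1))) ^ 3) / (2 ^ 16) ^ i"
      by (intro divide_right_mono card) simp
    also have "\<dots> = 2 ^ 16 * (real W + 1) ^ 3 * (2 ^ (15 * i) / 2 ^ (16 * i))"
    proof -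
      have "(2 ^ (5 * (i + 1))) ^ 3 = (2::real) ^ 15 * 2 ^ (15 * i)"
        by (simp only: flip: power_mult power_add) (simp add: algebra_simps)
      then show ?thesis by (simp add: power_mult add.commute)
    qed
    also have "(2::real) ^ (15 * i) / 2 ^ (16 * i) = (1/2) ^ i"
    proof -
      have "(2::real) ^ (16 * i) = 2 ^ (15 * i) * 2 ^ i"
        by (simp flip: power_add)
      then show ?thesis by (simp add: power_one_over)
    qed
    finally show ?thesis .
  qed
  have "(\<Sum>p\<in>Q. 1 / real p) = (\<Sum>i\<in>{a..<b}. \<Sum>p\<in>{p \<in> Q. j p = i}. 1 / real p)"
    by (rule sum.group[symmetric]) (use assms(1) a b in auto)
  also have "\<dots> \<le> (\<Sum>i\<in>{a..<b}. 2 ^ 16 * (real W + 1) ^ 3 * (1/2) ^ i)"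
    by (intro sum_mono block)
  also have "\<dots> = 2 ^ 16 * (real W + 1) ^ 3 * (\<Sum>i\<in>{a..<b}. (1/2) ^ i)"
    by (simp add: sum_distrib_left)
  also have "\<dots> \<le> 2 ^ 16 * (real W + 1) ^ 3 * (2 * (1/2) ^ a)"
    by (intro mult_left_mono sum_half_powers_le) simp
  finally show ?thesis by (simp add: algebra_simps)
qed

subsection \<open>Mean values over the prime factors\<close>

text \<open>A divisor c of m gives a factorization m = c e with m^s = c^s e^s. The pairs (c, e)
  obtained are all different and occur among the terms of the expanded square.\<close>

lemma sum_divisor_count_powr_le:
  fixes s :: real
  assumes A: "A \<subseteq> {1..Y}"
  shows "(\<Sum>m\<in>A. real (card {c. c dvd m}) * real m powr s) \<le> (\<Sum>c\<in>{1..Y}. real c powr s)\<^sup>2"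
proof -
  have fin: "finite A" using A finite_subset by blast
  have pos: "m > 0" if "m \<in> A" for m using that A by auto
  define h where "h = (\<lambda>(m, c). (c, m div c) :: nat \<times> nat)"
  define g where "g = (\<lambda>(c, e). real c powr s * real e powr s)"
  let ?S = "SIGMA m:A. {c. c dvd m}"
  have inj: "inj_on h ?S"
    unfolding h_def by (rule inj_onI) (auto, metis dvd_mult_div_cancel)
  have "(\<Sum>m\<in>A. real (card {c. c dvd m}) * real m powr s) = (\<Sum>m\<in>A. \<Sum>c\<in>{c. c dvd m}. g (h (m, c)))"
  proof (rule sum.cong[OF refl])
    fix m assume "m \<in> A"
    have "g (h (m, c)) = real m powr s" if "c dvd m" for c
      using that by (auto simp: g_def h_def simp flip: powr_mult of_nat_mult)
    then have "(\<Sum>c\<in>{c. c dvd m}. g (h (m, c))) = (\<Sum>c\<in>{c. c dvd m}. real m powr s)"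
      by (intro sum.cong) auto
    then show "real (card {c. c dvd m}) * real m powr s = (\<Sum>c\<in>{c. c dvd m}. g (h (m, c)))"
      by simp
  qed
  also have "\<dots> = (\<Sum>x\<in>?S. g (h x))"
    using fin pos by (subst sum.Sigma) auto
  also have "\<dots> = sum g (h ` ?S)"
    by (simp add: sum.reindex[OF inj])
  also have "\<dots> \<le> sum g ({1..Y} \<times> {1..Y})"
  proof (intro sum_mono2)
    show "h ` ?S \<subseteq> {1..Y} \<times> {1..Y}"
    proof clarify
      fix x y m c assume *: "(x, y) = h (m, c)" "m \<in> A" "c dvd m"
      then have m: "1 \<le> m" "m \<le> Y" using A by auto
      then have c: "1 \<le> c" "c \<le> m" using * by (auto intro: dvd_imp_le Suc_leI dvd_pos_nat)
      then have "1 \<le> m div c" by (auto simp: div_greater_zero_iff Suc_leI)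
      moreover have "m div c \<le> Y" using m(2) div_le_dividend order.trans by blast
      ultimately show "x \<in> {1..Y} \<and> y \<in> {1..Y}" using * c m by (auto simp: h_def)
    qed
  qed (auto simp: g_def)
  also have "\<dots> = (\<Sum>c\<in>{1..Y}. real c powr s)\<^sup>2"
    by (simp add: g_def power2_eq_square sum_product sum.cartesian_product)
  finally show ?thesis .
qed

text \<open>The term for \<open>n = 0\<close> vanishes, because \<open>0 powr s = 0\<close>.\<close>
definition zeta_17_16 :: real where
  "zeta_17_16 = (\<Sum>n. real n powr (- (17/16)))"

lemma sum_powr_le_zeta: "(\<Sum>c\<in>{1..Y}. real c powr (- (17/16))) \<le> zeta_17_16"
  unfolding zeta_17_16_def
  by (rule sum_le_suminf) (auto simp: summable_real_powr_iff)

text \<open>The gcd is one of the common divisors c of p - 1 and q - 1, so it may be replaced by the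
  sum over all of them. For fixed c the numbers (q - 1) / c are distinct positive integers, hence
  the sum of c / q is at most \<open>harm Y\<close>. What remains is the number of divisors of p -
  1, handled by \<open>sum_divisor_count_powr_le\<close>.\<close>

lemma sum_gcd_le:
  assumes P: "finite P" "\<And>p. p \<in> P \<Longrightarrow> 2 \<le> p \<and> p \<le> Y \<and> 2 ^ (16 * a) \<le> p"
  shows "(\<Sum>p\<in>P. \<Sum>q\<in>P. real (gcd (p - 1) (q - 1)) * real p powr (- (9/8)) / real q)
    \<le> (1/2) ^ a * harm Y * zeta_17_16\<^sup>2"
proof -
  have inner: "(\<Sum>q\<in>P. real (gcd (p - 1) (q - 1)) / real q) \<le> real (card {c. c dvd p - 1}) * harm Y"
    if p: "p \<in> P" for p
  proof -
    have p1: "p - 1 > 0" using P(2)[OF p] by simp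
    have fin: "finite {c. c dvd p - 1}" using p1 by simp
    have "(\<Sum>q\<in>P. real (gcd (p - 1) (q - 1)) / real q)
        \<le> (\<Sum>q\<in>P. \<Sum>c\<in>{c. c dvd p - 1}. if c dvd q - 1 then real c / real q else 0)"
    proof (rule sum_mono)
      fix q assume "q \<in> P"
      let ?g = "gcd (p - 1) (q - 1)"
      have "real ?g / real q = (if ?g dvd q - 1 then real ?g / real q else 0)" by simp
      also have "\<dots> \<le> (\<Sum>c\<in>{c. c dvd p - 1}. if c dvd q - 1 then real c / real q else 0)"
        by (rule member_le_sum) (use fin in auto)
      finally show "real ?g / real q \<le> (\<Sum>c\<in>{c. c dvd p - 1}. if c dvd q - 1 then real c / real q else 0)" .
    qed
    also have "\<dots> = (\<Sum>c\<in>{c. c dvd p - 1}. \<Sum>q\<in>P. if c dvd q - 1 then real c / real q else 0)"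
      by (rule sum.swap)
    also have "\<dots> \<le> (\<Sum>c\<in>{c. c dvd p - 1}. harm Y)"
    proof (rule sum_mono)
      fix c assume c: "c \<in> {c. c dvd p - 1}"
      then have c0: "c > 0" using p1 by (auto intro!: Nat.gr0I)
      let ?Q = "{q \<in> P. c dvd q - 1}"
      have finQ: "finite ?Q" using P by simp
      have "(\<Sum>q\<in>P. if c dvd q - 1 then real c / real q else 0) = (\<Sum>q\<in>?Q. real c / real q)"
        using P(1) by (simp add: sum.inter_filter)
      also have "\<dots> \<le> (\<Sum>q\<in>?Q. inverse (real ((q - 1) div c)))"
      proof (rule sum_mono)
        fix q assume q: "q \<in> ?Q"
        then obtain k where k: "q - 1 = c * k" by auto
        have q2: "q \<ge> 2" using q P by auto
        then have "k > 0" using k by (cases k) auto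
        moreover have "real c * real k \<le> real q"
          using k q2 by (simp flip: of_nat_mult)
        moreover have "(q - 1) div c = k" using k c0 by simp
        ultimately show "real c / real q \<le> inverse (real ((q - 1) div c))"
          using q2 by (simp add: field_simps)
      qed
      also have "\<dots> = (\<Sum>k\<in>(\<lambda>q. (q - 1) div c) ` ?Q. inverse (real k))"
      proof (subst sum.reindex)
        show "inj_on (\<lambda>q. (q - 1) div c) ?Q"
        proof (rule inj_onI)
          fix q q' assume *: "q \<in> ?Q" "q' \<in> ?Q" "(q - 1) div c = (q' - 1) div c"
          then have "q - 1 = q' - 1" by (metis (no_types, lifting) dvd_mult_div_cancel mem_Collect_eq)
          moreover have "q \<ge> 2" "q' \<ge> 2" using * P by auto
          ultimately show "q = q'" by simp
        qed
      qed simp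
      also have "\<dots> \<le> (\<Sum>k\<in>{1..Y}. inverse (real k))"
      proof (rule sum_mono2)
        show "(\<lambda>q. (q - 1) div c) ` ?Q \<subseteq> {1..Y}"
        proof clarify
          fix q assume q: "q \<in> P" "c dvd q - 1"
          then obtain k where k: "q - 1 = c * k" by auto
          have q2: "2 \<le> q" "q \<le> Y" using q P by auto
          then have "k > 0" using k by (cases k) auto
          moreover have "k \<le> Y"
            using order.trans[of k "c * k" Y] c0 k q2 by auto
          ultimately show "(q - 1) div c \<in> {1..Y}" using k q2 c0 by simp
        qed
      qed auto
      finally show "(\<Sum>q\<in>P. if c dvd q - 1 then real c / real q else 0) \<le> harm Y"
        by (simp add: harm_def)
    qed
    finally show ?thesis by simp
  qed
  \<comment> \<open>The exponent splits as 9/8 = 1/16 + 17/16: the first part yields the small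
    factor, the second part still exceeds 1.\<close>
  have powr_le: "real p powr (- (9/8)) \<le> (1/2) ^ a * real (p - 1) powr (- (17/16))" if p: "p \<in> P" for p
  proof -
    have p2: "2 \<le> p" "2 ^ (16 * a) \<le> p" using P(2)[OF p] by auto
    have "real (2 ^ (16 * a)) \<le> real p" using p2 by (simp only: of_nat_le_iff)
    then have "real p powr (- (1/16)) \<le> (2 ^ (16 * a)) powr (- (1/16))"
      by (intro powr_mono2') auto
    also have "(2 ^ (16 * a)) powr (- (1/16)) = (1/2 :: real) ^ a"
      by (simp add: powr_powr powr_minus power_one_over inverse_eq_divide flip: powr_realpow)
    finally have 1: "real p powr (- (1/16)) \<le> (1/2) ^ a" .
    have 2: "real p powr (- (17/16)) \<le> real (p - 1) powr (- (17/16))"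
      using p2 by (intro powr_mono2') auto
    have "real p powr (- (9/8)) = real p powr (- (1/16)) * real p powr (- (17/16))"
      by (simp flip: powr_add)
    also have "\<dots> \<le> (1/2) ^ a * real (p - 1) powr (- (17/16))"
      by (intro mult_mono 1 2) auto
    finally show ?thesis .
  qed
  have "(\<Sum>p\<in>P. \<Sum>q\<in>P. real (gcd (p - 1) (q - 1)) * real p powr (- (9/8)) / real q)
      = (\<Sum>p\<in>P. real p powr (- (9/8)) * (\<Sum>q\<in>P. real (gcd (p - 1) (q - 1)) / real q))"
    by (simp add: sum_distrib_left mult_ac)
  also have "\<dots> \<le> (\<Sum>p\<in>P. ((1/2) ^ a * real (p - 1) powr (- (17/16))) * (real (card {c. c dvd p - 1}) * harm Y))"
    by (intro sum_mono mult_mono inner powr_le sum_nonneg) auto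
  also have "\<dots> = (1/2) ^ a * harm Y * (\<Sum>p\<in>P. real (card {c. c dvd p - 1}) * real (p - 1) powr (- (17/16)))"
    by (simp add: sum_distrib_left mult_ac)
  also have "(\<Sum>p\<in>P. real (card {c. c dvd p - 1}) * real (p - 1) powr (- (17/16)))
      = (\<Sum>m\<in>(\<lambda>p. p - 1) ` P. real (card {c. c dvd m}) * real m powr (- (17/16)))"
    by (subst sum.reindex) (use P in \<open>force simp: inj_on_def\<close>)+
  also have "\<dots> \<le> (\<Sum>c\<in>{1..Y}. real c powr (- (17/16)))\<^sup>2"
    by (rule sum_divisor_count_powr_le) (use P in force)
  also have "\<dots> \<le> zeta_17_16\<^sup>2"
    by (intro power_mono sum_powr_le_zeta sum_nonneg) auto
  finally show ?thesis by (simp add: mult_left_mono harm_nonneg)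
qed

text \<open>The square is expanded into correlations. The diagonal is bounded trivially; off the
  diagonal \<open>lsym_correlation\<close> is applied with the smaller prime as the one moving along
  an orbit. The orders divide p - 1 and q - 1, which brings the gcd into the form of
  \<open>sum_gcd_le\<close>.\<close>

lemma second_moment_lsym:
  assumes P: "finite P" "\<And>p. p \<in> P \<Longrightarrow> prime p \<and> 2 < p \<and> p \<le> Y \<and> 2 ^ (16 * a) \<le> p \<and> p ^ 5 \<le> ord p 2 ^ 8"
  shows "(\<Sum>n\<in>{1..N}. (\<Sum>p\<in>{p \<in> P. p dvd n}. lsym p n)\<^sup>2)
    \<le> real N * (\<Sum>p\<in>P. 1 / real p) + 2 * real N * ((1/2) ^ a * harm Y * zeta_17_16\<^sup>2) + 2 * real Y ^ 4"
proof -
  define g where "g p n = (if p dvd n then lsym p n else 0)" for p n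
  define C where "C p q = (\<Sum>n\<in>{1..N}. g p n * g q n)" for p q
  \<comment> \<open>Up to N / (p q) terms are summed, and sqrt p / \<open>ord p 2\<close> is at most
    p^(-1/8); together with 1/p this gives the exponent 9/8. The error p q is at most Y^2.\<close>
  define B where "B p q = real N * (real (gcd (p - 1) (q - 1)) * real p powr (- (9/8)) / real q) + real Y ^ 2" for p q
  have B0: "B p q \<ge> 0" for p q by (simp add: B_def)
  have diag: "C p p \<le> real N * (1 / real p)" if p: "p \<in> P" for p
  proof -
    have p0: "p > 0" using P(2)[OF p] by simp
    have "C p p \<le> (\<Sum>n\<in>{1..N}. if p dvd n then 1 else 0)"
      unfolding C_def g_def by (intro sum_mono) (use abs_lsym_le[of p] in \<open>auto simp: abs_le_square_iff[of _ 1, simplified] power2_eq_square\<close>)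
    also have "\<dots> = real (N div p)"
      using sum_multiples[OF p0, of "\<lambda>_. 1" N] by simp
    also have "\<dots> \<le> real N / real p" by (rule of_nat_div_le_of_nat)
    finally show ?thesis by simp
  qed
  have C_sym: "C p q = C q p" for p q by (simp add: C_def mult.commute)
  have off: "C p q \<le> B p q" if p: "p \<in> P" and q: "q \<in> P" and pq: "p < q" for p q
  proof -
    from P(2)[OF p] have p': "prime p" "2 < p" "p \<le> Y" "p ^ 5 \<le> ord p 2 ^ 8" by auto
    from P(2)[OF q] have q': "prime q" "2 < q" "q \<le> Y" by auto
    define d where "d = ord p 2"
    have d: "d > 0" using ord_2_bounds[OF p'(1,2)] by (simp add: d_def)
    have "coprime p q" using p' q' pq primes_coprime by blast
    then have dvd: "p dvd n \<and> q dvd n \<longleftrightarrow> p * q dvd n" for n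
      by (meson divides_mult dvd_mult_left dvd_mult_right)
    have "C p q = (\<Sum>n\<in>{1..N}. if p * q dvd n then lsym p n * lsym q n else 0)"
      unfolding C_def g_def by (intro sum.cong refl) (auto simp flip: dvd)
    also have "\<dots> = (\<Sum>m<N div (p * q). lsym p (p * q * (m + 1)) * lsym q (p * q * (m + 1)))"
      using p' q' by (intro sum_multiples) simp
    also have "\<dots> \<le> real (N div (p * q)) * sqrt (real p) * real (gcd (ord p 2) (ord q 2)) / real (ord p 2) + real p * real q"
      using lsym_correlation[OF p'(1,2) q'(1) pq, of "N div (p * q)"] by linarith
    also have "\<dots> = real (N div (p * q)) * (real (gcd (ord p 2) (ord q 2)) * (sqrt (real p) / real d)) + real p * real q"
      by (simp add: d_def)
    also have "\<dots> \<le> (real N / (real p * real q)) * (real (gcd (p - 1) (q - 1)) * real p powr (- (1/8))) + real Y * real Y"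
    proof (intro add_mono mult_mono)
      show "real (N div (p * q)) \<le> real N / (real p * real q)"
        using of_nat_div_le_of_nat[of N "p * q"] by simp
      have "gcd (ord p 2) (ord q 2) dvd gcd (p - 1) (q - 1)"
        using ord_dvd_prime_minus_1[OF p'(1,2)] ord_dvd_prime_minus_1[OF q'(1,2)] by (simp add: gcd_dvdI1 gcd_dvdI2)
      then show "real (gcd (ord p 2) (ord q 2)) \<le> real (gcd (p - 1) (q - 1))"
        using p'(2) by (intro of_nat_mono dvd_imp_le) auto
      have "real (p ^ 5) \<le> real (d ^ 8)" using p'(4) unfolding d_def by (simp only: of_nat_le_iff)
      then have "real p powr 5 \<le> real d powr 8"
        using p' d by (simp add: powr_numeral)
      then have "(real p powr 5) powr (1/8) \<le> (real d powr 8) powr (1/8)"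
        by (intro powr_mono2) auto
      then have "real p powr (5 * (1/8)) \<le> real d powr (8 * (1/8))"
        by (simp only: powr_powr)
      then have d_ge: "real p powr (5/8) \<le> real d" using d by simp
      have "sqrt (real p) / real d \<le> real p powr (1/2) / real p powr (5/8)"
        using d_ge p' d by (intro frac_le) (auto simp: powr_half_sqrt)
      also have "\<dots> = real p powr (- (1/8))" by (simp flip: powr_diff)
      finally show "sqrt (real p) / real d \<le> real p powr (- (1/8))" .
    qed (use p' q' in auto)
    also have "(real N / (real p * real q)) * (real (gcd (p - 1) (q - 1)) * real p powr (- (1/8)))
        = real N * (real (gcd (p - 1) (q - 1)) * real p powr (- (9/8)) / real q)"
    proof -
      have "real p powr (- (9/8)) = real p powr (- (1/8)) * real p powr (-1)"
        by (subst powr_add[symmetric]) simp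
      also have "real p powr (-1) = 1 / real p"
        using p' by (simp add: powr_minus inverse_eq_divide)
      finally have split: "real p powr (- (9/8)) = real p powr (- (1/8)) * (1 / real p)" .
      show ?thesis unfolding split by simp
    qed
    finally show ?thesis by (simp add: B_def power2_eq_square)
  qed
  have "(\<Sum>n\<in>{1..N}. (\<Sum>p\<in>{p \<in> P. p dvd n}. lsym p n)\<^sup>2) = (\<Sum>n\<in>{1..N}. (\<Sum>p\<in>P. g p n)\<^sup>2)"
    using P(1) by (simp add: g_def sum.inter_filter)
  also have "\<dots> = (\<Sum>n\<in>{1..N}. \<Sum>p\<in>P. \<Sum>q\<in>P. g p n * g q n)"
    by (simp add: power2_eq_square sum_product)
  also have "\<dots> = (\<Sum>p\<in>P. \<Sum>q\<in>P. C p q)"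
    unfolding C_def by (subst sum.swap, rule sum.cong[OF refl], rule sum.swap)
  also have "\<dots> \<le> (\<Sum>p\<in>P. \<Sum>q\<in>P. (if p = q then real N * (1 / real p) else 0)
      + (if p < q then B p q else 0) + (if q < p then B q p else 0))"
  proof (intro sum_mono)
    fix p q assume pq: "p \<in> P" "q \<in> P"
    consider "p < q" | "p = q" | "q < p" by linarith
    then show "C p q \<le> (if p = q then real N * (1 / real p) else 0)
      + (if p < q then B p q else 0) + (if q < p then B q p else 0)"
    proof cases
      case 1
      then show ?thesis using off[OF pq] by simp
    next
      case 2
      then show ?thesis using diag[OF pq(1)] by simp
    next
      case 3
      then show ?thesis using off[OF pq(2,1)] by (simp add: C_sym[of p q])
    qed
  qed
  also have "\<dots> = (\<Sum>p\<in>P. \<Sum>q\<in>P. if p = q then real N * (1 / real p) else 0)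
      + (\<Sum>p\<in>P. \<Sum>q\<in>P. if p < q then B p q else 0) + (\<Sum>p\<in>P. \<Sum>q\<in>P. if q < p then B q p else 0)"
    by (simp add: sum.distrib)
  also have "(\<Sum>p\<in>P. \<Sum>q\<in>P. if q < p then B q p else 0) = (\<Sum>p\<in>P. \<Sum>q\<in>P. if p < q then B p q else 0)"
    by (rule sum.swap)
  also have "(\<Sum>p\<in>P. \<Sum>q\<in>P. if p = q then real N * (1 / real p) else 0) = real N * (\<Sum>p\<in>P. 1 / real p)"
    using P(1) by (simp add: sum_distrib_left)
  finally have 1: "(\<Sum>n\<in>{1..N}. (\<Sum>p\<in>{p \<in> P. p dvd n}. lsym p n)\<^sup>2)
      \<le> real N * (\<Sum>p\<in>P. 1 / real p) + 2 * (\<Sum>p\<in>P. \<Sum>q\<in>P. if p < q then B p q else 0)"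
    by simp
  \<comment> \<open>Dropping the condition p < q is harmless because \<open>B\<close> is
    nonnegative, and it lets the sum over q be taken first.\<close>
  have "(\<Sum>p\<in>P. \<Sum>q\<in>P. if p < q then B p q else 0) \<le> (\<Sum>p\<in>P. \<Sum>q\<in>P. B p q)"
    by (intro sum_mono) (use B0 in auto)
  also have "\<dots> = real N * (\<Sum>p\<in>P. \<Sum>q\<in>P. real (gcd (p - 1) (q - 1)) * real p powr (- (9/8)) / real q)
      + (real (card P) * real (card P)) * real Y ^ 2"
    by (simp add: B_def sum.distrib sum_distrib_left)
  also have "\<dots> \<le> real N * ((1/2) ^ a * harm Y * zeta_17_16\<^sup>2) + (real Y * real Y) * real Y ^ 2"
  proof (intro add_mono mult_left_mono mult_right_mono mult_mono)
    show "(\<Sum>p\<in>P. \<Sum>q\<in>P. real (gcd (p - 1) (q - 1)) * real p powr (- (9/8)) / real q)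
        \<le> (1/2) ^ a * harm Y * zeta_17_16\<^sup>2"
      by (rule sum_gcd_le) (use P in \<open>auto simp: less_imp_le\<close>)
    have "P \<subseteq> {1..Y}" using P by force
    then have "card P \<le> card {1..Y}" by (intro card_mono) auto
    then show "real (card P) \<le> real Y" "real (card P) \<le> real Y" by auto
  qed auto
  finally show ?thesis using 1 by (simp add: power4_eq_xxxx power2_eq_square algebra_simps)
qed

text \<open>Turan's argument. Rounding only hurts in the first moment, which needs a lower bound and
  loses at most 1 per prime; this is the term with \<open>card P\<close>. In the second moment
  rounding down is simply dropped, and the terms of order M^2 cancel.\<close>

lemma turan_variance:
  assumes P: "finite P" "\<And>p. p \<in> P \<Longrightarrow> prime p"
  defines "M \<equiv> (\<Sum>p\<in>P. 1 / real p)"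
  shows "(\<Sum>n\<in>{1..N}. (real (card {p \<in> P. p dvd n}) - M)\<^sup>2) \<le> real N * M + 2 * M * real (card P)"
proof -
  define g where "g p n = (if p dvd n then 1 else 0 :: real)" for p n :: nat
  define w where "w n = (\<Sum>p\<in>P. g p n)" for n
  have w_eq: "real (card {p \<in> P. p dvd n}) = w n" for n
    unfolding w_def g_def using P(1) by (simp add: sum.inter_filter[symmetric])
  have M0: "M \<ge> 0" unfolding M_def by (intro sum_nonneg) auto
  have p0: "p > 0" if "p \<in> P" for p using P(2)[OF that] prime_gt_0_nat by blast
  have single: "(\<Sum>n\<in>{1..N}. g p n) = real (N div p)" if "p \<in> P" for p
    using sum_multiples[OF p0[OF that], of "\<lambda>_. 1" N] by (simp add: g_def)
  have lower: "(\<Sum>n\<in>{1..N}. w n) \<ge> real N * M - real (card P)"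
  proof -
    have "(\<Sum>n\<in>{1..N}. w n) = (\<Sum>p\<in>P. \<Sum>n\<in>{1..N}. g p n)"
      unfolding w_def by (rule sum.swap)
    also have "\<dots> = (\<Sum>p\<in>P. real (N div p))" by (intro sum.cong refl single)
    also have "\<dots> \<ge> (\<Sum>p\<in>P. real N * (1 / real p) - 1)"
    proof (rule sum_mono)
      fix p assume p: "p \<in> P"
      have "N < (N div p + 1) * p" using p0[OF p] by (simp add: dividend_less_div_times)
      then have "real N < real ((N div p + 1) * p)" by (simp only: of_nat_less_iff)
      then have "real N < (real (N div p) + 1) * real p" by (simp add: algebra_simps)
      then show "real N * (1 / real p) - 1 \<le> real (N div p)"
        using p0[OF p] by (simp add: field_simps)
    qed
    finally show ?thesis by (simp add: sum_subtractf M_def sum_distrib_left)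
  qed
  have upper: "(\<Sum>n\<in>{1..N}. (w n)\<^sup>2) \<le> real N * M + real N * M\<^sup>2"
  proof -
    have "(\<Sum>n\<in>{1..N}. (w n)\<^sup>2) = (\<Sum>n\<in>{1..N}. \<Sum>p\<in>P. \<Sum>q\<in>P. g p n * g q n)"
      by (simp add: w_def power2_eq_square sum_product)
    also have "\<dots> = (\<Sum>p\<in>P. \<Sum>q\<in>P. \<Sum>n\<in>{1..N}. g p n * g q n)"
      by (subst sum.swap, rule sum.cong[OF refl], rule sum.swap)
    also have "\<dots> \<le> (\<Sum>p\<in>P. \<Sum>q\<in>P. (if p = q then real N * (1 / real p) else 0)
        + real N * (1 / real p * (1 / real q)))"
    proof (intro sum_mono)
      fix p q assume pq: "p \<in> P" "q \<in> P"
      show "(\<Sum>n\<in>{1..N}. g p n * g q n) \<le> (if p = q then real N * (1 / real p) else 0)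
        + real N * (1 / real p * (1 / real q))"
      proof (cases "p = q")
        case True
        have "(\<Sum>n\<in>{1..N}. g p n * g q n) = (\<Sum>n\<in>{1..N}. g p n)"
          unfolding True g_def by (intro sum.cong) auto
        also have "\<dots> \<le> real N / real p"
          using single[OF pq(1)] of_nat_div_le_of_nat[of N p] by simp
        finally show ?thesis using True by (simp add: add_increasing2)
      next
        case False
        then have "coprime p q" using P pq primes_coprime by blast
        then have dvd: "p dvd n \<and> q dvd n \<longleftrightarrow> p * q dvd n" for n
          by (meson divides_mult dvd_mult_left dvd_mult_right)
        have "(\<Sum>n\<in>{1..N}. g p n * g q n) = (\<Sum>n\<in>{1..N}. if p * q dvd n then 1 else 0)"
          unfolding g_def by (intro sum.cong refl) (auto simp flip: dvd)
        also have "\<dots> = real (N div (p * q))"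
          using sum_multiples[of "p * q" "\<lambda>_. 1" N] p0 pq by simp
        also have "\<dots> \<le> real N / real (p * q)" by (rule of_nat_div_le_of_nat)
        finally show ?thesis using False by simp
      qed
    qed
    also have "\<dots> = real N * (\<Sum>p\<in>P. 1 / real p) + real N * (\<Sum>p\<in>P. \<Sum>q\<in>P. 1 / real p * (1 / real q))"
      using P(1) unfolding sum.distrib sum_distrib_left by simp
    also have "\<dots> = real N * M + real N * M\<^sup>2"
      by (simp only: M_def power2_eq_square sum_product)
    finally show ?thesis .
  qed
  have "(\<Sum>n\<in>{1..N}. (w n - M)\<^sup>2) = (\<Sum>n\<in>{1..N}. (w n)\<^sup>2 - 2 * M * w n + M\<^sup>2)"
    by (intro sum.cong refl) (simp add: power2_diff algebra_simps)
  also have "\<dots> = (\<Sum>n\<in>{1..N}. (w n)\<^sup>2) - 2 * M * (\<Sum>n\<in>{1..N}. w n) + real N * M\<^sup>2"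
    by (simp add: sum.distrib sum_subtractf sum_distrib_left)
  also have "\<dots> \<le> (real N * M + real N * M\<^sup>2) - 2 * M * (real N * M - real (card P)) + real N * M\<^sup>2"
    using upper mult_left_mono[OF lower, of "2 * M"] M0 by linarith
  also have "\<dots> = real N * M + 2 * M * real (card P)"
    by (simp add: power2_eq_square algebra_simps)
  finally show ?thesis by (simp add: w_eq)
qed

section \<open>From moment bounds to a bound for the number of elements of
  \<open>setC\<close>\<close>

lemma markov_card:
  fixes f :: "'a \<Rightarrow> real"
  assumes "finite A" "\<And>n. n \<in> A \<Longrightarrow> f n \<ge> 0" "c > 0"
  shows "real (card {n \<in> A. f n \<ge> c}) \<le> (\<Sum>n\<in>A. f n) / c"
proof -
  have "real (card {n \<in> A. f n \<ge> c}) * c = (\<Sum>n\<in>{n \<in> A. f n \<ge> c}. c)" by simp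
  also have "\<dots> \<le> (\<Sum>n\<in>{n \<in> A. f n \<ge> c}. f n)" by (rule sum_mono) simp
  also have "\<dots> \<le> (\<Sum>n\<in>A. f n)" by (rule sum_mono2) (use assms in auto)
  finally show ?thesis using assms(3) by (simp add: field_simps)
qed

lemma setC_cong_prime:
  assumes "n \<in> setC"
  obtains j where "\<And>p. prime p \<Longrightarrow> p dvd n \<Longrightarrow> [(2::int) ^ (n + 1) - 1 = 2 ^ j] (mod int p)"
proof -
  from assms obtain j where j: "[(2::int) ^ (n + 1) - 1 = 2 ^ j] (mod int n)"
    by (auto simp: setC_def)
  show thesis
    by (rule that[of j]) (use j in \<open>auto intro: cong_dvd_modulus\<close>)
qed

text \<open>Compared with the trivial bound for the number of prime factors in \<open>P\<close>, the
  density estimate for non-exceptional primes saves the factor sqrt(3 / W).\<close>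

lemma sum_card_hits_pow2_le:
  assumes P: "finite P" "\<And>p. p \<in> P \<Longrightarrow> prime p \<and> 2 < p \<and> p \<le> Y \<and> \<not> exceptional W p"
    and W: "W > 0"
  shows "(\<Sum>n\<in>{1..N}. real (card {p \<in> P. p dvd n \<and> hits_pow2 p (n + 1)}))
    \<le> real N * (\<Sum>p\<in>P. 1 / real p) * sqrt (3 / real W) + real Y ^ 2"
proof -
  have dens: "real (card {a. a < ord p 2 \<and> hits_pow2 p a}) / real (ord p 2) \<le> sqrt (3 / real W)"
    if "p \<in> P" for p
  proof (rule real_le_rsqrt)
    from P(2)[OF that] have p: "prime p" "2 < p" "\<not> exceptional W p" by auto
    have d: "ord p 2 > 0" using ord_2_bounds[OF p(1,2)] by simp
    show "(real (card {a. a < ord p 2 \<and> hits_pow2 p a}) / real (ord p 2))\<^sup>2 \<le> 3 / real W"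
      using density_hits_pow2[OF p] d W by (simp add: power_divide field_simps)
  qed
  have "(\<Sum>n\<in>{1..N}. real (card {p \<in> P. p dvd n \<and> hits_pow2 p (n + 1)}))
      = (\<Sum>n\<in>{1..N}. \<Sum>p\<in>P. if p dvd n \<and> hits_pow2 p (n + 1) then 1 else 0)"
    using P(1) by (simp add: sum.inter_filter[symmetric])
  also have "\<dots> = (\<Sum>p\<in>P. \<Sum>n\<in>{1..N}. if p dvd n \<and> hits_pow2 p (n + 1) then 1 else 0)"
    by (rule sum.swap)
  also have "\<dots> = (\<Sum>p\<in>P. real (card {n \<in> {1..N}. p dvd n \<and> hits_pow2 p (n + 1)}))"
    by (intro sum.cong refl) (subst sum.inter_filter[symmetric], simp_all)
  also have "\<dots> \<le> (\<Sum>p\<in>P. real N * (1 / real p) * sqrt (3 / real W) + real Y)"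
  proof (rule sum_mono)
    fix p assume p: "p \<in> P"
    then have p': "prime p" "2 < p" "p \<le> Y" using P(2) by auto
    have "real (card {n \<in> {1..N}. p dvd n \<and> hits_pow2 p (n + 1)})
        \<le> real N / real p * (real (card {a. a < ord p 2 \<and> hits_pow2 p a}) / real (ord p 2)) + real p"
      by (rule card_multiples_hits_pow2[OF p'(1,2)])
    also have "\<dots> \<le> real N / real p * sqrt (3 / real W) + real Y"
      using p' by (intro add_mono mult_left_mono dens p) auto
    finally show "real (card {n \<in> {1..N}. p dvd n \<and> hits_pow2 p (n + 1)})
        \<le> real N * (1 / real p) * sqrt (3 / real W) + real Y" by simp
  qed
  also have "\<dots> = real N * (\<Sum>p\<in>P. 1 / real p) * sqrt (3 / real W) + real (card P) * real Y"
    by (simp add: sum.distrib sum_distrib_left sum_distrib_right)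
  also have "real (card P) * real Y \<le> real Y ^ 2"
  proof -
    have "P \<subseteq> {1..Y}" using P by force
    then have "card P \<le> card {1..Y}" by (intro card_mono) auto
    then show ?thesis by (simp add: power2_eq_square mult_right_mono)
  qed
  finally show ?thesis by simp
qed

lemma sum_card_divisors_le:
  assumes "finite P" "\<And>p. p \<in> P \<Longrightarrow> p > 0"
  shows "(\<Sum>n\<in>{1..N}. real (card {p \<in> P. p dvd n})) \<le> real N * (\<Sum>p\<in>P. 1 / real p)"
proof -
  have "(\<Sum>n\<in>{1..N}. real (card {p \<in> P. p dvd n})) = (\<Sum>n\<in>{1..N}. \<Sum>p\<in>P. if p dvd n then 1 else 0)"
    using assms(1) by (simp add: sum.inter_filter[symmetric])
  also have "\<dots> = (\<Sum>p\<in>P. \<Sum>n\<in>{1..N}. if p dvd n then 1 else 0)" by (rule sum.swap)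
  also have "\<dots> \<le> (\<Sum>p\<in>P. real N * (1 / real p))"
  proof (rule sum_mono)
    fix p assume "p \<in> P"
    then have "(\<Sum>n\<in>{1..N}. if p dvd n then 1 else 0) = real (N div p)"
      using sum_multiples[of p "\<lambda>_. 1" N] assms(2) by simp
    also have "\<dots> \<le> real N / real p" by (rule of_nat_div_le_of_nat)
    finally show "(\<Sum>n\<in>{1..N}. if p dvd n then 1 else 0) \<le> real N * (1 / real p)" by simp
  qed
  finally show ?thesis by (simp add: sum_distrib_left)
qed

text \<open>Pigeonhole over four classes of primes: \<open>P1\<close>, \<open>E\<close>, and the two
  halves of \<open>P2\<close> according to the symbol of 2. On each half all terms equal 1,
  respectively (-1)^j with one common j, so the absolute value of the sum is the number of prime
  factors in that half.\<close>

lemma setC_dichotomy: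
  assumes n: "n \<in> setC" and finP: "finite P" and P: "\<And>p. p \<in> P \<Longrightarrow> prime p \<and> 2 < p"
    and cover: "P = P1 \<union> E \<union> P2" and disj: "P1 \<inter> E = {}" "(P1 \<union> E) \<inter> P2 = {}"
  defines "cnt \<equiv> \<lambda>Q. real (card {p \<in> Q. p dvd n})"
  assumes many: "c \<le> cnt P"
  shows "c / 4 \<le> real (card {p \<in> P1. p dvd n \<and> hits_pow2 p (n + 1)})
    \<or> c / 4 \<le> cnt E
    \<or> c / 4 \<le> \<bar>\<Sum>p\<in>{p \<in> {p \<in> P2. chi p 2 = 1}. p dvd n}. lsym p n\<bar>
    \<or> c / 4 \<le> \<bar>\<Sum>p\<in>{p \<in> {p \<in> P2. chi p 2 = -1}. p dvd n}. lsym p n\<bar>"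
proof -
  obtain j where j: "\<And>p. prime p \<Longrightarrow> p dvd n \<Longrightarrow> [(2::int) ^ (n + 1) - 1 = 2 ^ j] (mod int p)"
    using setC_cong_prime[OF n] by blast
  have hits: "hits_pow2 p (n + 1)" if "p \<in> P" "p dvd n" for p
    unfolding hits_pow2_def using j that P by blast
  have lsym_eq: "lsym p n = real_of_int (chi p 2) ^ j" if "p \<in> P" "p dvd n" for p
  proof -
    from P[OF that(1)] have p: "prime p" "2 < p" by auto
    have "chi p (2 ^ (n + 1) - 1) = chi p (2 ^ j)" by (rule chi_cong[OF j[OF p(1) that(2)]])
    then show ?thesis by (simp add: lsym_def chi_power[OF p])
  qed
  let ?A = "{p \<in> P2. chi p 2 = 1}" and ?B = "{p \<in> P2. chi p 2 = -1}"
  have sub: "P1 \<subseteq> P" "E \<subseteq> P" "P2 \<subseteq> P" using cover by auto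
  have sumA: "(\<Sum>p\<in>{p \<in> ?A. p dvd n}. lsym p n) = cnt ?A"
  proof -
    have "(\<Sum>p\<in>{p \<in> ?A. p dvd n}. lsym p n) = (\<Sum>p\<in>{p \<in> ?A. p dvd n}. 1)"
      by (intro sum.cong refl) (use lsym_eq sub in auto)
    then show ?thesis by (simp add: cnt_def)
  qed
  have sumB: "\<bar>\<Sum>p\<in>{p \<in> ?B. p dvd n}. lsym p n\<bar> = cnt ?B"
  proof -
    have "(\<Sum>p\<in>{p \<in> ?B. p dvd n}. lsym p n) = (\<Sum>p\<in>{p \<in> ?B. p dvd n}. (-1) ^ j)"
      by (intro sum.cong refl) (use lsym_eq sub in auto)
    then show ?thesis by (simp add: cnt_def abs_mult)
  qed
  have P2_eq: "P2 = ?A \<union> ?B"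
  proof -
    have "chi p 2 = 1 \<or> chi p 2 = -1" if "p \<in> P2" for p
    proof -
      have p: "prime p" "2 < p" using P sub that by auto
      then have "\<not> int p dvd 2" using zdvd_not_zless[of 2 "int p"] by simp
      then show ?thesis using chi_values[of 2 p] chi_eq_0_iff[of 2 p] by auto
    qed
    then show ?thesis by auto
  qed
  have "{p \<in> P. p dvd n} = {p \<in> P1. p dvd n} \<union> {p \<in> E. p dvd n} \<union> {p \<in> ?A. p dvd n} \<union> {p \<in> ?B. p dvd n}"
    using cover P2_eq by blast
  then have "card {p \<in> P. p dvd n}
      = card ({p \<in> P1. p dvd n} \<union> {p \<in> E. p dvd n} \<union> {p \<in> ?A. p dvd n} \<union> {p \<in> ?B. p dvd n})"
    by (rule arg_cong[where f = card])
  also have "\<dots> \<le> card {p \<in> P1. p dvd n} + card {p \<in> E. p dvd n}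
      + card {p \<in> ?A. p dvd n} + card {p \<in> ?B. p dvd n}"
    by (intro order.trans[OF card_Un_le] add_mono order.refl)
  finally have "cnt P \<le> cnt P1 + cnt E + cnt ?A + cnt ?B"
    unfolding cnt_def of_nat_add[symmetric] by (rule of_nat_mono)
  moreover have "{p \<in> P1. p dvd n} = {p \<in> P1. p dvd n \<and> hits_pow2 p (n + 1)}"
    using hits sub by auto
  then have "cnt P1 = real (card {p \<in> P1. p dvd n \<and> hits_pow2 p (n + 1)})"
    by (simp add: cnt_def)
  ultimately show ?thesis using many sumA sumB by linarith
qed

text \<open>Each alternative of \<open>setC_dichotomy\<close>, and the event of too few prime
  factors in \<open>P\<close>, is rare by Markov's inequality. The constant 132 is 4 from the
  variance plus 64 from each of the two mean squares.\<close>

lemma card_setC_le: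
  assumes P: "finite P" "\<And>p. p \<in> P \<Longrightarrow> prime p \<and> 2 < p \<and> p \<le> Y \<and> 2 ^ (16 * a) \<le> p"
    and W: "W > 0"
  defines "M \<equiv> (\<Sum>p\<in>P. 1 / real p)"
  assumes M: "M \<ge> 1"
  shows "real (card {n \<in> {1..N}. n \<in> setC}) \<le> real N *
      (132 / M + 8 * sqrt (3 / real W) + 2 ^ 20 * (real W + 1) ^ 3 * (1/2) ^ a
        + 256 * (1/2) ^ a * harm Y * zeta_17_16\<^sup>2) + 272 * real Y ^ 4"
proof -
  define E where "E = {p \<in> P. ord p 2 ^ 8 < p ^ 5 \<and> exceptional W p}"
  define P1 where "P1 = {p \<in> P. ord p 2 ^ 8 < p ^ 5 \<and> \<not> exceptional W p}"
  define P2 where "P2 = {p \<in> P. p ^ 5 \<le> ord p 2 ^ 8}"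
  define A where "A = {p \<in> P2. chi p 2 = 1}"
  define B where "B = {p \<in> P2. chi p 2 = -1}"
  define I where "I = {1..N}"
  have finI: "finite I" by (simp add: I_def)
  have fin: "finite E" "finite P1" "finite P2" "finite A" "finite B"
    using P(1) by (auto simp: E_def P1_def P2_def A_def B_def)
  have sub: "E \<subseteq> P" "P1 \<subseteq> P" "A \<subseteq> P" "B \<subseteq> P" "A \<subseteq> P2" "B \<subseteq> P2"
    by (auto simp: E_def P1_def P2_def A_def B_def)
  have mass_le: "(\<Sum>p\<in>Q. 1 / real p) \<le> M" if "Q \<subseteq> P" for Q
    unfolding M_def by (rule sum_mono2) (use that P in auto)
  have Y: "real Y \<ge> 1"
  proof -
    have "P \<noteq> {}" using M by (auto simp: M_def)
    with P(2) show ?thesis by fastforce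
  qed
  have cardP: "real (card P) \<le> real Y"
  proof -
    have "P \<subseteq> {1..Y}" using P by force
    then have "card P \<le> card {1..Y}" by (intro card_mono) auto
    then show ?thesis by simp
  qed
  have Y4: "real Y \<le> real Y ^ 4" "real Y ^ 2 \<le> real Y ^ 4"
    using power_increasing[of 1 4 "real Y"] power_increasing[of 2 4 "real Y"] Y by auto
  \<comment> \<open>Outside \<open>U1\<close> more than M / 2 primes of \<open>P\<close> divide n; a
    quarter of this is the threshold M / 8 of the other sets.\<close>
  define U1 where "U1 = {n \<in> I. (real (card {p \<in> P. p dvd n}) - M)\<^sup>2 \<ge> (M / 2)\<^sup>2}"
  define U2 where "U2 = {n \<in> I. real (card {p \<in> P1. p dvd n \<and> hits_pow2 p (n + 1)}) \<ge> M / 8}"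
  define U3 where "U3 = {n \<in> I. real (card {p \<in> E. p dvd n}) \<ge> M / 8}"
  define U where "U Q = {n \<in> I. (\<Sum>p\<in>{p \<in> Q. p dvd n}. lsym p n)\<^sup>2 \<ge> (M / 8)\<^sup>2}" for Q
  have sq_ge: "(M / k)\<^sup>2 \<le> x\<^sup>2" if "M / k \<le> \<bar>x\<bar>" "k > 0" for x k
    using that M by (metis abs_of_nonneg abs_le_square_iff divide_nonneg_pos dual_order.trans zero_le_one)
  have "{n \<in> {1..N}. n \<in> setC} \<subseteq> U1 \<union> U2 \<union> U3 \<union> U A \<union> U B"
  proof
    fix n assume n: "n \<in> {n \<in> {1..N}. n \<in> setC}"
    then have nI: "n \<in> I" by (simp add: I_def)
    show "n \<in> U1 \<union> U2 \<union> U3 \<union> U A \<union> U B"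
    proof (cases "M / 2 \<le> real (card {p \<in> P. p dvd n})")
      case False
      then have "M / 2 \<le> \<bar>real (card {p \<in> P. p dvd n}) - M\<bar>" by linarith
      then have "n \<in> U1" using nI sq_ge[of 2] by (simp add: U1_def)
      then show ?thesis by blast
    next
      case True
      have "M / 2 / 4 \<le> real (card {p \<in> P1. p dvd n \<and> hits_pow2 p (n + 1)})
        \<or> M / 2 / 4 \<le> real (card {p \<in> E. p dvd n})
        \<or> M / 2 / 4 \<le> \<bar>\<Sum>p\<in>{p \<in> {p \<in> P2. chi p 2 = 1}. p dvd n}. lsym p n\<bar>
        \<or> M / 2 / 4 \<le> \<bar>\<Sum>p\<in>{p \<in> {p \<in> P2. chi p 2 = -1}. p dvd n}. lsym p n\<bar>"
        by (rule setC_dichotomy[OF _ P(1)]) (use n P True in \<open>auto simp: E_def P1_def P2_def\<close>)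
      then consider "M / 8 \<le> real (card {p \<in> P1. p dvd n \<and> hits_pow2 p (n + 1)})"
        | "M / 8 \<le> real (card {p \<in> E. p dvd n})"
        | "M / 8 \<le> \<bar>\<Sum>p\<in>{p \<in> A. p dvd n}. lsym p n\<bar>"
        | "M / 8 \<le> \<bar>\<Sum>p\<in>{p \<in> B. p dvd n}. lsym p n\<bar>"
        unfolding A_def B_def by fastforce
      then show ?thesis
        by cases (use nI sq_ge[of 8] in \<open>auto simp: U2_def U3_def U_def\<close>)
    qed
  qed
  then have "card {n \<in> {1..N}. n \<in> setC} \<le> card (U1 \<union> U2 \<union> U3 \<union> U A \<union> U B)"
    by (rule card_mono[rotated]) (auto simp: U1_def U2_def U3_def U_def finI)
  also have "\<dots> \<le> card U1 + card U2 + card U3 + card (U A) + card (U B)"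
    by (intro order.trans[OF card_Un_le] add_mono order.refl)
  finally have "real (card {n \<in> {1..N}. n \<in> setC})
      \<le> real (card U1) + real (card U2) + real (card U3) + real (card (U A)) + real (card (U B))"
    by linarith
  then have total: "real (card {n \<in> {1..N}. n \<in> setC})
      \<le> real (card U1) + real (card U2) + real (card U3) + (real (card (U A)) + real (card (U B)))"
    by simp
  have U1_le: "real (card U1) \<le> real N * (4 / M) + 8 * real Y ^ 4"
  proof -
    have "real (card U1) \<le> (\<Sum>n\<in>I. (real (card {p \<in> P. p dvd n}) - M)\<^sup>2) / (M / 2)\<^sup>2"
      unfolding U1_def by (rule markov_card) (use finI M in auto)
    also have "\<dots> \<le> (real N * M + 2 * M * real (card P)) / (M / 2)\<^sup>2"
      unfolding I_def M_def by (intro divide_right_mono turan_variance) (use P in auto)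
    also have "\<dots> = real N * (4 / M) + 8 * (real (card P) / M)"
      using M by (simp add: power2_eq_square field_simps)
    also have "\<dots> \<le> real N * (4 / M) + 8 * real Y ^ 4"
    proof -
      have "real (card P) / M \<le> real (card P) / 1" using M by (intro divide_left_mono) auto
      then show ?thesis using cardP Y4 by linarith
    qed
    finally show ?thesis .
  qed
  have U2_le: "real (card U2) \<le> real N * (8 * sqrt (3 / real W)) + 8 * real Y ^ 4"
  proof -
    have "real (card U2) \<le> (\<Sum>n\<in>I. real (card {p \<in> P1. p dvd n \<and> hits_pow2 p (n + 1)})) / (M / 8)"
      unfolding U2_def by (rule markov_card) (use finI M in auto)
    also have "\<dots> \<le> (real N * (\<Sum>p\<in>P1. 1 / real p) * sqrt (3 / real W) + real Y ^ 2) / (M / 8)"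
      unfolding I_def
      by (intro divide_right_mono sum_card_hits_pow2_le) (use P W M in \<open>auto simp: P1_def\<close>)
    also have "\<dots> \<le> (real N * M * sqrt (3 / real W) + real Y ^ 2) / (M / 8)"
      by (intro divide_right_mono add_mono mult_right_mono mult_left_mono mass_le sub) (use M in auto)
    also have "\<dots> = real N * (8 * sqrt (3 / real W)) + 8 * (real Y ^ 2 / M)"
      using M by (simp add: field_simps)
    also have "\<dots> \<le> real N * (8 * sqrt (3 / real W)) + 8 * real Y ^ 4"
    proof -
      have "real Y ^ 2 / M \<le> real Y ^ 2 / 1" using M by (intro divide_left_mono) auto
      then show ?thesis using Y4 by linarith
    qed
    finally show ?thesis .
  qed
  have U3_le: "real (card U3) \<le> real N * (2 ^ 20 * (real W + 1) ^ 3 * (1/2) ^ a)"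
  proof -
    have "real (card U3) \<le> (\<Sum>n\<in>I. real (card {p \<in> E. p dvd n})) / (M / 8)"
      unfolding U3_def by (rule markov_card) (use finI M in auto)
    \<comment> \<open>The reciprocal sum over \<open>E\<close> will be so small that the gain from
      \<open>M\<close> can be given away.\<close>
    also have "\<dots> \<le> (\<Sum>n\<in>I. real (card {p \<in> E. p dvd n})) / (1 / 8)"
      using M by (intro divide_left_mono sum_nonneg) auto
    also have "\<dots> = 8 * (\<Sum>n\<in>I. real (card {p \<in> E. p dvd n}))" by simp
    also have "\<dots> \<le> 8 * (real N * (\<Sum>p\<in>E. 1 / real p))"
      unfolding I_def by (intro mult_left_mono sum_card_divisors_le) (use fin(1) P(2) sub(1) prime_gt_0_nat in \<open>auto dest!: subsetD\<close>)
    also have "\<dots> \<le> 8 * (real N * (2 ^ 17 * (real W + 1) ^ 3 * (1/2) ^ a))"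
      by (intro mult_left_mono sum_inverse_exceptional_le) (use fin P(2) in \<open>auto simp: E_def\<close>)
    finally show ?thesis by simp
  qed
  have UQ: "real (card (U Q)) \<le> real N * (64 / M + 128 * (1/2) ^ a * harm Y * zeta_17_16\<^sup>2) + 128 * real Y ^ 4"
    if Q: "Q \<subseteq> P2" for Q
  proof -
    let ?R = "(1/2) ^ a * harm Y * zeta_17_16\<^sup>2 :: real"
    have QP: "Q \<subseteq> P" using Q by (auto simp: P2_def)
    have R0: "?R \<ge> 0" by (simp add: harm_nonneg)
    have "real (card (U Q)) \<le> (\<Sum>n\<in>I. (\<Sum>p\<in>{p \<in> Q. p dvd n}. lsym p n)\<^sup>2) / (M / 8)\<^sup>2"
      unfolding U_def by (rule markov_card) (use finI M in auto)
    also have "\<dots> \<le> (real N * (\<Sum>p\<in>Q. 1 / real p) + 2 * real N * ?R + 2 * real Y ^ 4) / (M / 8)\<^sup>2"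
      unfolding I_def
      by (intro divide_right_mono second_moment_lsym)
        (use Q P finite_subset[OF QP P(1)] in \<open>auto simp: P2_def\<close>)
    also have "\<dots> \<le> (real N * M + 2 * real N * ?R + 2 * real Y ^ 4) / (M / 8)\<^sup>2"
      by (intro divide_right_mono add_right_mono mult_left_mono mass_le QP) auto
    also have "\<dots> = real N * (64 / M) + (128 * real N * ?R + 128 * real Y ^ 4) / M\<^sup>2"
      using M by (simp add: power2_eq_square field_simps)
    also have "\<dots> \<le> real N * (64 / M) + (128 * real N * ?R + 128 * real Y ^ 4) / 1"
    proof (intro add_left_mono divide_left_mono)
      show "1 \<le> M\<^sup>2" using M by (simp add: one_le_power)
      show "0 \<le> 128 * real N * ?R + 128 * real Y ^ 4" using R0 by simp
    qed (use M in auto)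
    also have "\<dots> = real N * (64 / M + 128 * (1/2) ^ a * harm Y * zeta_17_16\<^sup>2) + 128 * real Y ^ 4"
      by (simp add: algebra_simps)
    finally show ?thesis .
  qed
  have UAB: "real (card (U A)) + real (card (U B))
      \<le> 2 * (real N * (64 / M + 128 * (1/2) ^ a * harm Y * zeta_17_16\<^sup>2) + 128 * real Y ^ 4)"
    unfolding mult_2 by (intro add_mono UQ sub)
  have "real (card {n \<in> {1..N}. n \<in> setC})
      \<le> (real N * (4 / M) + 8 * real Y ^ 4) + (real N * (8 * sqrt (3 / real W)) + 8 * real Y ^ 4)
        + real N * (2 ^ 20 * (real W + 1) ^ 3 * (1/2) ^ a)
        + 2 * (real N * (64 / M + 128 * (1/2) ^ a * harm Y * zeta_17_16\<^sup>2) + 128 * real Y ^ 4)"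
    by (rule order.trans[OF total]) (intro add_mono U1_le U2_le U3_le UAB)
  also have "\<dots> = real N *
      (132 / M + 8 * sqrt (3 / real W) + 2 ^ 20 * (real W + 1) ^ 3 * (1/2) ^ a
        + 256 * (1/2) ^ a * harm Y * zeta_17_16\<^sup>2) + 272 * real Y ^ 4"
    by (simp add: algebra_simps)
  finally show ?thesis .
qed

subsection \<open>Sums of reciprocals of primes\<close>

text \<open>Let h(A) be the truncated sum. An n counted for A with p added is either counted for A,
  or n = p m with m counted again, so h(A + p) is at most h(A) + h(A + p) / p. Solving for h(A + p)
  yields the Euler factor without infinite series.\<close>

lemma sum_inverse_smooth_le_euler_product:
  assumes "finite A" "\<And>p. p \<in> A \<Longrightarrow> prime p"
  shows "(\<Sum>n\<in>{n \<in> {1..N}. prime_factors n \<subseteq> A}. 1 / real n) \<le> (\<Prod>p\<in>A. 1 / (1 - 1 / real p))"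
  using assms
proof (induction A rule: finite_induct)
  case empty
  have "{n \<in> {1..N}. prime_factors n \<subseteq> {}} \<subseteq> {1}"
    by (auto simp: prime_factorization_empty_iff)
  then have "(\<Sum>n\<in>{n \<in> {1..N}. prime_factors n \<subseteq> {}}. 1 / real n) \<le> (\<Sum>n\<in>{1}. 1 / real n)"
    by (intro sum_mono2) auto
  then show ?case by simp
next
  case (insert p A)
  define S where "S B = {n \<in> {1..N}. prime_factors n \<subseteq> B}" for B
  define h where "h B = (\<Sum>n\<in>S B. 1 / real n)" for B
  have p: "prime p" using insert.prems by simp
  have p2: "real p \<ge> 2" using prime_ge_2_nat[OF p] by simp
  have finS: "finite (S B)" for B by (simp add: S_def)
  have sub: "S (insert p A) \<subseteq> S A \<union> (\<lambda>m. p * m) ` S (insert p A)"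
  proof
    fix n assume n: "n \<in> S (insert p A)"
    show "n \<in> S A \<union> (\<lambda>m. p * m) ` S (insert p A)"
    proof (cases "p dvd n")
      case True
      then obtain m where m: "n = p * m" by auto
      have n1: "1 \<le> n" "n \<le> N" using n by (auto simp: S_def)
      with m have m0: "m > 0" by (cases m) auto
      have "m \<le> p * m" using prime_gt_0_nat[OF p] by simp
      then have "m \<le> N" using n1(2) unfolding m by (rule order.trans)
      moreover have "prime_factors m \<subseteq> prime_factors n"
        using n1 m by (intro dvd_prime_factors) auto
      ultimately have "m \<in> S (insert p A)" using n m0 by (auto simp: S_def)
      with m show ?thesis by blast
    next
      case False
      then have "p \<notin> prime_factors n" by auto
      with n show ?thesis by (auto simp: S_def)
    qed
  qed
  have "h (insert p A) \<le> (\<Sum>n\<in>S A \<union> (\<lambda>m. p * m) ` S (insert p A). 1 / real n)"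
    unfolding h_def by (intro sum_mono2 sub) (auto simp: finS)
  also have "\<dots> \<le> h A + (\<Sum>n\<in>(\<lambda>m. p * m) ` S (insert p A). 1 / real n)"
    unfolding h_def using sum.union_inter[OF finS finite_imageI[OF finS], of "\<lambda>n. 1 / real n" A "\<lambda>m. p * m" "insert p A"]
      sum_nonneg[of "S A \<inter> (\<lambda>m. p * m) ` S (insert p A)" "\<lambda>n. 1 / real n"] by simp
  also have "(\<Sum>n\<in>(\<lambda>m. p * m) ` S (insert p A). 1 / real n) = (1 / real p) * h (insert p A)"
    unfolding h_def using p2 by (subst sum.reindex) (auto simp: inj_on_def sum_distrib_left)
  finally have "h (insert p A) * (1 - 1 / real p) \<le> h A" by (simp add: algebra_simps)
  then have "h (insert p A) \<le> 1 / (1 - 1 / real p) * h A"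
    using p2 by (simp add: field_simps)
  also have "\<dots> \<le> 1 / (1 - 1 / real p) * (\<Prod>p\<in>A. 1 / (1 - 1 / real p))"
    using insert.IH insert.prems p2 by (intro mult_left_mono) (auto simp: h_def S_def)
  finally show ?case
    using insert.hyps by (simp add: h_def S_def)
qed

lemma inverse_one_minus_le_exp:
  fixes u :: real
  assumes "0 \<le> u" "u \<le> 1/2"
  shows "1 / (1 - u) \<le> exp (2 * u)"
proof -
  have "1 / (1 - u) = 1 + u / (1 - u)" using assms by (simp add: field_simps)
  also have "\<dots> \<le> exp (u / (1 - u))" by (rule exp_ge_add_one_self)
  also have "u / (1 - u) \<le> u / (1/2)" using assms by (intro divide_left_mono) auto
  finally show ?thesis by (simp add: mult.commute)
qed

text \<open>Euler's argument: all n up to Y have only prime factors up to Y, so the harmonic sum is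
  below the Euler product. The loss of a factor 2 comes from
  \<open>inverse_one_minus_le_exp\<close>.\<close>

lemma sum_inverse_primes_ge:
  assumes "Y \<ge> 2"
  shows "ln (ln (real Y + 1)) / 2 \<le> (\<Sum>p\<in>{p. prime p \<and> p \<le> Y}. 1 / real p)"
proof -
  let ?A = "{p. prime p \<and> p \<le> Y}"
  have fin: "finite ?A" by simp
  have smooth: "{n \<in> {1..Y}. prime_factors n \<subseteq> ?A} = {1..Y}"
    by (auto dest!: dvd_imp_le)
  have "ln (real Y + 1) \<le> harm Y" by (rule harm_ge_ln)
  also have "harm Y = (\<Sum>n\<in>{n \<in> {1..Y}. prime_factors n \<subseteq> ?A}. 1 / real n)"
    unfolding smooth by (simp add: harm_def inverse_eq_divide)
  also have "\<dots> \<le> (\<Prod>p\<in>?A. 1 / (1 - 1 / real p))"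
    by (rule sum_inverse_smooth_le_euler_product) auto
  also have "\<dots> \<le> (\<Prod>p\<in>?A. exp (2 * (1 / real p)))"
  proof (rule prod_mono, safe)
    fix p :: nat assume "prime p"
    then have "real p \<ge> 2" using prime_ge_2_nat[of p] by simp
    then have u: "0 \<le> 1 / real p" "1 / real p \<le> 1/2" by (auto simp: field_simps)
    then show "0 \<le> 1 / (1 - 1 / real p)" by simp
    show "1 / (1 - 1 / real p) \<le> exp (2 * (1 / real p))"
      by (rule inverse_one_minus_le_exp[OF u])
  qed
  also have "\<dots> = exp (2 * (\<Sum>p\<in>?A. 1 / real p))"
    using fin by (simp add: exp_sum sum_distrib_left)
  finally have "ln (real Y + 1) \<le> exp (2 * (\<Sum>p\<in>?A. 1 / real p))" .
  moreover have "0 < ln (real Y + 1)" using assms by simp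
  ultimately have "ln (ln (real Y + 1)) \<le> 2 * (\<Sum>p\<in>?A. 1 / real p)"
    using ln_le_cancel_iff[of "ln (real Y + 1)" "exp (2 * (\<Sum>p\<in>?A. 1 / real p))"] by simp
  then show ?thesis by simp
qed

text \<open>Chebyshev's argument with n = 2^j: every prime in (n, 2 n] divides the central binomial
  coefficient, which is at most 2^(2 n), and each of these primes exceeds 2^j.\<close>

lemma card_primes_dyadic_le:
  "j * card {p :: nat. prime p \<and> 2 ^ j < p \<and> p \<le> 2 ^ (j + 1)} \<le> 2 * 2 ^ j"
proof -
  define n :: nat where "n = 2 ^ j"
  define Q where "Q = {p. prime p \<and> 2 ^ j < p \<and> p \<le> (2 :: nat) ^ (j + 1)}"
  define C where "C = (2 * n) choose n"
  have finQ: "finite Q" unfolding Q_def by (rule finite_subset[of _ "{..2 ^ (j + 1)}"]) auto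
  have C0: "C > 0" by (simp add: C_def zero_less_binomial)
  have fact_eq: "fact n * fact n * C = (fact (2 * n) :: nat)"
    using binomial_fact_lemma[of n "2 * n"] by (simp add: C_def)
  have "p dvd C" if "p \<in> Q" for p
  proof -
    from that have p: "prime p" "n < p" "p \<le> 2 * n" by (auto simp: Q_def n_def)
    then have "p dvd fact n * fact n * C"
      unfolding fact_eq by (simp add: prime_dvd_fact_iff)
    moreover have "\<not> p dvd fact n" using p by (simp add: prime_dvd_fact_iff)
    ultimately show ?thesis using p(1) by (simp add: prime_dvd_mult_iff)
  qed
  then have dvd: "\<Prod>Q dvd C"
    by (intro prod_primes_dvd finQ) (auto simp: Q_def)
  have "2 ^ (j * card Q) = (\<Prod>p\<in>Q. (2 :: nat) ^ j)" by (simp only: prod_constant power_mult)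
  also have "\<dots> \<le> \<Prod>Q" by (rule prod_mono) (auto simp: Q_def)
  also have "\<dots> \<le> C" using dvd C0 by (rule dvd_imp_le)
  also have "C \<le> (\<Sum>k\<le>2 * n. (2 * n) choose k)"
    unfolding C_def by (rule member_le_sum) auto
  also have "\<dots> = 2 ^ (2 * n)" by (rule choose_row_sum)
  finally have "j * card Q \<le> 2 * n" by simp
  then show ?thesis by (simp add: Q_def n_def)
qed

lemma harm_le_ln: "n > 0 \<Longrightarrow> harm n \<le> 1 + ln (real n)"
proof -
  assume "n > 0"
  then obtain m where m: "n = Suc m" by (cases n) auto
  have "harm (Suc m) - ln (real (Suc m)) \<le> harm (Suc 0) - ln (real (Suc 0))"
    by (rule decseqD[OF decseq_harm_diff_ln]) simp
  then show ?thesis by (simp add: m harm_def)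
qed

text \<open>By \<open>card_primes_dyadic_le\<close> the primes in (2^j, 2^(j+1)] contribute at most
  2 / j; only the prime 2 lies below the first block.\<close>

lemma sum_inverse_primes_le:
  "(\<Sum>p\<in>{p. prime p \<and> p \<le> 2 ^ Suc J}. 1 / real p) \<le> 1 + 2 * harm J"
proof (induction J)
  case 0
  have "{p. prime p \<and> p \<le> (2 :: nat) ^ Suc 0} \<subseteq> {2}"
    by (auto dest: prime_ge_2_nat)
  then have "(\<Sum>p\<in>{p. prime p \<and> p \<le> (2 :: nat) ^ Suc 0}. 1 / real p) \<le> (\<Sum>p\<in>{2 :: nat}. 1 / real p)"
    by (intro sum_mono2) auto
  then show ?case by (simp add: harm_def)
next
  case (Suc i)
  define j where "j = Suc i"
  define B where "B = {p. prime p \<and> 2 ^ j < p \<and> p \<le> (2 :: nat) ^ (j + 1)}"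
  have finB: "finite B" unfolding B_def by (rule finite_subset[of _ "{..2 ^ (j + 1)}"]) auto
  have "(\<Sum>p\<in>B. 1 / real p) \<le> (\<Sum>p\<in>B. 1 / 2 ^ j)"
  proof (rule sum_mono)
    fix p assume "p \<in> B"
    then have "2 ^ j \<le> p" by (simp add: B_def)
    then have "real (2 ^ j) \<le> real p" by (simp only: of_nat_le_iff)
    then have "2 ^ j \<le> real p" by simp
    then show "1 / real p \<le> 1 / 2 ^ j" by (intro frac_le) auto
  qed
  also have "\<dots> = real (card B) / 2 ^ j" by simp
  also have "\<dots> \<le> 2 / real j"
  proof -
    have "real (j * card B) \<le> real (2 * 2 ^ j)"
      using card_primes_dyadic_le[of j] unfolding B_def by (simp only: of_nat_le_iff)
    then have "real j * real (card B) \<le> 2 * 2 ^ j" by simp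
    moreover have "real j > 0" by (simp add: j_def)
    ultimately show ?thesis by (simp add: divide_simps mult.commute)
  qed
  finally have block: "(\<Sum>p\<in>B. 1 / real p) \<le> 2 / real j" .
  have le: "p \<le> 2 ^ Suc j" if "p \<le> 2 ^ j" for p :: nat
    using that power_increasing[of j "Suc j" "2 :: nat"] by simp
  have "{p. prime p \<and> p \<le> (2 :: nat) ^ Suc j} = {p. prime p \<and> p \<le> 2 ^ j} \<union> B"
    unfolding B_def using le by (auto simp del: power_Suc)
  then have "(\<Sum>p\<in>{p. prime p \<and> p \<le> (2 :: nat) ^ Suc j}. 1 / real p)
      = (\<Sum>p\<in>{p. prime p \<and> p \<le> 2 ^ j} \<union> B. 1 / real p)"
    by (rule arg_cong)
  also have "\<dots> = (\<Sum>p\<in>{p. prime p \<and> p \<le> 2 ^ j}. 1 / real p) + (\<Sum>p\<in>B. 1 / real p)"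
    by (rule sum.union_disjoint) (use finB in \<open>auto simp: B_def\<close>)
  also have "\<dots> \<le> (1 + 2 * harm i) + 2 / real j"
    using Suc.IH block unfolding j_def by (rule add_mono)
  also have "\<dots> = 1 + 2 * harm (Suc i)"
    by (simp add: harm_Suc j_def inverse_eq_divide)
  finally show ?case unfolding j_def .
qed

subsection \<open>The counting function\<close>

text \<open>Removing the primes up to 2^(16 a) costs only about 2 ln(16 a). For \<open>a\<close> of
  order ln ln x this is of order ln ln ln x and does not affect the main term.\<close>

lemma sum_inverse_primes_interval_ge:
  assumes "Y \<ge> 2" "a > 0"
  shows "(\<Sum>p\<in>{p. prime p \<and> 2 ^ (16 * a) \<le> p \<and> p \<le> Y}. 1 / real p)
    \<ge> ln (ln (real Y + 1)) / 2 - 3 - 2 * ln (16 * real a)"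
proof -
  define P where "P = {p. prime p \<and> 2 ^ (16 * a) \<le> p \<and> p \<le> Y}"
  define S where "S = {p. prime p \<and> p \<le> (2 :: nat) ^ (16 * a)}"
  obtain J where J: "16 * a = Suc J" using assms(2) by (cases "16 * a") auto
  have fin: "finite P" "finite S" by (auto simp: P_def S_def)
  have "{p. prime p \<and> p \<le> Y} \<subseteq> P \<union> S" by (auto simp: P_def S_def)
  then have "(\<Sum>p\<in>{p. prime p \<and> p \<le> Y}. 1 / real p) \<le> (\<Sum>p\<in>P \<union> S. 1 / real p)"
    using fin by (intro sum_mono2) auto
  also have "\<dots> \<le> (\<Sum>p\<in>P. 1 / real p) + (\<Sum>p\<in>S. 1 / real p)"
    using sum.union_inter[OF fin, of "\<lambda>p. 1 / real p"] sum_nonneg[of "P \<inter> S" "\<lambda>p. 1 / real p"] by simp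
  also have "(\<Sum>p\<in>S. 1 / real p) \<le> 1 + 2 * harm J"
    unfolding S_def J by (rule sum_inverse_primes_le)
  also have "(harm J :: real) \<le> harm (16 * a)" by (rule harm_mono) (simp add: J)
  also have "harm (16 * a) \<le> 1 + ln (16 * real a)"
    using harm_le_ln[of "16 * a"] assms(2) by simp
  finally have "(\<Sum>p\<in>{p. prime p \<and> p \<le> Y}. 1 / real p) \<le> (\<Sum>p\<in>P. 1 / real p) + (1 + 2 * (1 + ln (16 * real a)))"
    by simp
  with sum_inverse_primes_ge[OF assms(1)] show ?thesis by (simp add: P_def)
qed

text \<open>Parameters are inserted into \<open>card_setC_le\<close>. All that is needed for large x
  is collected first as asymptotic inequalities in x alone; the third one yields M >= ln(ln x) /
  4.\<close>

lemma card_setC_asymptotic: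
  "\<exists>C>0. eventually (\<lambda>x. real (card {n \<in> {1..nat \<lfloor>x\<rfloor>}. n \<in> setC}) \<le> C * x / ln (ln x) powr (1/7)) at_top"
proof -
  \<comment> \<open>Three main terms and the error term contribute 1 each, the gcd sum contributes
    the rest.\<close>
  define C where "C = 4 + 256 * zeta_17_16\<^sup>2"
  have "eventually (\<lambda>x::real. x > exp (exp 1)) at_top" by (rule eventually_gt_at_top)
  moreover have "eventually (\<lambda>x::real. x powr (1/8) > 2) at_top" by real_asymp
  moreover have "eventually (\<lambda>x::real. ln (ln x / 8) / 2 - 3 - 2 * ln (16 * (2 * log 2 (ln x) + 1)) \<ge> ln (ln x) / 4) at_top"
    unfolding log_def by real_asymp
  moreover have "eventually (\<lambda>x::real. ln (ln x) / 4 \<ge> 1) at_top" by real_asymp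
  moreover have "eventually (\<lambda>x::real. 132 / (ln (ln x) / 4) \<le> 1 / ln (ln x) powr (1/7)) at_top" by real_asymp
  moreover have "eventually (\<lambda>x::real. 8 * sqrt (3 / ln (ln x)) \<le> 1 / ln (ln x) powr (1/7)) at_top" by real_asymp
  moreover have "eventually (\<lambda>x::real. 2 ^ 20 * (ln (ln x) + 2) ^ 3 * (1 / ln x ^ 2) \<le> 1 / ln (ln x) powr (1/7)) at_top" by real_asymp
  moreover have "eventually (\<lambda>x::real. (1 / ln x ^ 2) * (1 + ln x) \<le> 1 / ln (ln x) powr (1/7)) at_top" by real_asymp
  moreover have "eventually (\<lambda>x::real. 272 * sqrt x \<le> x * (1 / ln (ln x) powr (1/7))) at_top" by real_asymp
  ultimately have "eventually (\<lambda>x. real (card {n \<in> {1..nat \<lfloor>x\<rfloor>}. n \<in> setC}) \<le> C * x / ln (ln x) powr (1/7)) at_top"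
  proof eventually_elim
    case (elim x)
    define N where "N = nat \<lfloor>x\<rfloor>"
    \<comment> \<open>This makes the error Y^4 at most sqrt x. The choice of \<open>a\<close> gives
      2^a >= (ln x)^2, which absorbs \<open>harm Y\<close> and the cube of W + 1; \<open>W\<close>
      only has to tend to infinity fast enough for sqrt(3 / W).\<close>
    define Y where "Y = nat \<lfloor>x powr (1/8)\<rfloor>"
    define a where "a = nat \<lceil>2 * log 2 (ln x)\<rceil>"
    define W where "W = nat \<lceil>ln (ln x)\<rceil>"
    define P where "P = {p. prime p \<and> 2 ^ (16 * a) \<le> p \<and> p \<le> Y}"
    define M where "M = (\<Sum>p\<in>P. 1 / real p)"
    define r where "r = 1 / ln (ln x) powr (1/7)"
    have x0: "x > 0" using elim(1) by (meson exp_gt_zero less_trans)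
    have lnx: "ln x > exp 1" using elim(1) x0 by (metis exp_gt_zero ln_exp ln_less_cancel_iff)
    then have lnx1: "ln x > 1" by (meson less_trans one_less_exp_iff zero_less_one)
    have lnlnx: "ln (ln x) > 1" using lnx lnx1 by (metis exp_gt_zero less_trans ln_exp ln_less_cancel_iff zero_less_one)
    have N: "real N \<le> x" using x0 by (simp add: N_def)
    have Y: "real Y \<le> x powr (1/8)" "x powr (1/8) < real Y + 1" by (auto simp: Y_def)
    have Y2: "Y \<ge> 2" using elim(2) by (simp add: Y_def le_nat_iff le_floor_iff)
    have log_pos: "log 2 (ln x) > 0" using lnx1 by simp
    have a: "2 * log 2 (ln x) \<le> real a" "real a \<le> 2 * log 2 (ln x) + 1" "a > 0"
    proof -
      have "real a = of_int \<lceil>2 * log 2 (ln x)\<rceil>" using log_pos by (simp add: a_def)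
      then show "2 * log 2 (ln x) \<le> real a" "real a \<le> 2 * log 2 (ln x) + 1" "a > 0"
        using log_pos ceiling_correct[of "2 * log 2 (ln x)"] by linarith+
    qed
    have W: "ln (ln x) \<le> real W" "real W \<le> ln (ln x) + 1" "W > 0"
    proof -
      have "real W = of_int \<lceil>ln (ln x)\<rceil>" using lnlnx by (simp add: W_def)
      then show "ln (ln x) \<le> real W" "real W \<le> ln (ln x) + 1" "W > 0"
        using lnlnx ceiling_correct[of "ln (ln x)"] by linarith+
    qed
    have half_pow: "(1/2 :: real) ^ a \<le> 1 / ln x ^ 2"
    proof -
      have "ln x ^ 2 = 2 powr (2 * log 2 (ln x))"
        using lnx1 by (simp add: powr_powr[symmetric] mult.commute[of 2] powr_numeral)
      also have "\<dots> \<le> 2 powr real a" using a by (intro powr_mono) auto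
      finally have "ln x ^ 2 \<le> 2 ^ a" by (simp add: powr_realpow)
      then show ?thesis using lnx1 by (simp add: power_one_over divide_left_mono)
    qed
    have harmY: "harm Y \<le> 1 + ln x"
    proof -
      have "harm Y \<le> 1 + ln (real Y)" using Y2 by (intro harm_le_ln) simp
      also have "ln (real Y) \<le> ln (x powr (1/8))" using Y Y2 by (intro ln_mono) auto
      also have "\<dots> = ln x / 8" using x0 by (simp add: ln_powr)
      also have "\<dots> \<le> ln x" using lnx1 by simp
      finally show ?thesis by simp
    qed
    have M_ge: "M \<ge> ln (ln x) / 4"
    proof -
      have "ln (ln x / 8) \<le> ln (ln (real Y + 1))"
      proof -
        have "ln x / 8 = ln (x powr (1/8))" using x0 by (simp add: ln_powr)
        also have "\<dots> \<le> ln (real Y + 1)" using Y x0 by (intro ln_mono) auto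
        finally show ?thesis using lnx1 by (intro ln_mono) auto
      qed
      moreover have "ln (16 * real a) \<le> ln (16 * (2 * log 2 (ln x) + 1))"
        using a by (intro ln_mono) auto
      ultimately show ?thesis
        using sum_inverse_primes_interval_ge[OF Y2 a(3)] elim(3) unfolding M_def P_def by linarith
    qed
    then have M1: "M \<ge> 1" using elim(4) by linarith
    have two_less: "2 < p" if "2 ^ (16 * a) \<le> p" for p :: nat
    proof -
      have "(2 :: nat) ^ 2 \<le> 2 ^ (16 * a)" using a(3) by (intro power_increasing) auto
      with that show ?thesis by simp
    qed
    have "real (card {n \<in> {1..N}. n \<in> setC}) \<le> real N *
      (132 / M + 8 * sqrt (3 / real W) + 2 ^ 20 * (real W + 1) ^ 3 * (1/2) ^ a
        + 256 * (1/2) ^ a * harm Y * zeta_17_16\<^sup>2) + 272 * real Y ^ 4"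
      unfolding M_def
    proof (rule card_setC_le)
      show "finite P" by (simp add: P_def)
      show "1 \<le> (\<Sum>p\<in>P. 1 / real p)" using M1 by (simp add: M_def)
    qed (use two_less W in \<open>auto simp: P_def\<close>)
    also have "\<dots> \<le> x * (r + r + r + 256 * zeta_17_16\<^sup>2 * r) + x * r"
    proof (rule add_mono[OF mult_mono[OF N add_mono[OF add_mono[OF add_mono]]]])
      have "132 / M \<le> 132 / (ln (ln x) / 4)" using M_ge lnlnx M1 by (intro divide_left_mono) auto
      then show "132 / M \<le> r" using elim(5) unfolding r_def by linarith
      have "8 * sqrt (3 / real W) \<le> 8 * sqrt (3 / ln (ln x))"
        using W lnlnx by (intro mult_left_mono real_sqrt_le_mono divide_left_mono) auto
      then show "8 * sqrt (3 / real W) \<le> r" using elim(6) unfolding r_def by linarith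
      have "2 ^ 20 * (real W + 1) ^ 3 * (1/2) ^ a \<le> 2 ^ 20 * (ln (ln x) + 2) ^ 3 * (1 / ln x ^ 2)"
        using W lnlnx by (intro mult_mono half_pow power_mono order.refl) auto
      then show "2 ^ 20 * (real W + 1) ^ 3 * (1/2) ^ a \<le> r" using elim(7) unfolding r_def by linarith
      have "(1/2) ^ a * harm Y \<le> (1 / ln x ^ 2) * (1 + ln x)"
        using lnx1 by (intro mult_mono half_pow harmY) (auto simp: harm_nonneg)
      then have "(1/2) ^ a * harm Y \<le> r" using elim(8) unfolding r_def by linarith
      then have "(256 * zeta_17_16\<^sup>2) * ((1/2) ^ a * harm Y) \<le> (256 * zeta_17_16\<^sup>2) * r"
        by (intro mult_left_mono) auto
      then show "256 * (1/2) ^ a * harm Y * zeta_17_16\<^sup>2 \<le> 256 * zeta_17_16\<^sup>2 * r"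
        by (simp add: mult_ac)
      have "real Y ^ 4 \<le> (x powr (1/8)) ^ 4" using Y by (intro power_mono) auto
      also have "\<dots> = sqrt x" using x0 by (simp add: powr_half_sqrt[symmetric] powr_power)
      finally show "272 * real Y ^ 4 \<le> x * r" using elim(9) unfolding r_def by linarith
    qed (use x0 M1 in \<open>auto simp: harm_nonneg\<close>)
    also have "\<dots> \<le> C * (x * r)"
      using x0 by (simp add: C_def r_def algebra_simps)
    finally show ?case by (simp add: N_def r_def)
  qed
  moreover have "C > 0" by (simp add: C_def add_pos_nonneg)
  ultimately show ?thesis by blast
qed

section \<open>From large x to all x > e^e, and density zero\<close>

lemma mlog_pos: "mlog x > 0"
  by (simp add: mlog_def)

lemma mlog_mono: "0 < x \<Longrightarrow> x \<le> y \<Longrightarrow> mlog x \<le> mlog y"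
  unfolding mlog_def by (intro max.mono ln_mono) auto

lemma setC_upto: "x > 0 \<Longrightarrow> {n \<in> setC. real n \<le> x} = {n \<in> {1..nat \<lfloor>x\<rfloor>}. n \<in> setC}"
  by (auto simp: setC_def le_nat_iff le_floor_iff)

text \<open>Below the point \<open>x0\<close> where the asymptotic bound starts, the count is at
  most x and the denominator at most its value \<open>K\<close> at \<open>x0\<close>, so adding
  \<open>K\<close> to the constant covers this range.\<close>

lemma card_setC_mlog:
  "\<exists>c>0. \<forall>x::real. x > exp (exp 1) \<longrightarrow>
    real (card {n \<in> setC. real n \<le> x}) \<le> c * x / (mlog (mlog x)) powr (1/7)"
proof -
  obtain C x0 where C: "C > 0" and x0: "\<And>x. x \<ge> x0 \<Longrightarrow>
      real (card {n \<in> {1..nat \<lfloor>x\<rfloor>}. n \<in> setC}) \<le> C * x / ln (ln x) powr (1/7)"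
    using card_setC_asymptotic unfolding eventually_at_top_linorder by blast
  define K where "K = mlog (mlog x0) powr (1/7)"
  have K: "K > 0" using mlog_pos[of "mlog x0"] by (simp add: K_def)
  have "real (card {n \<in> setC. real n \<le> x}) \<le> (C + K) * x / (mlog (mlog x)) powr (1/7)"
    if x: "x > exp (exp 1)" for x
  proof -
    have xpos: "x > 0" using x by (meson exp_gt_zero less_trans)
    have lnx: "ln x > exp 1" using x xpos by (metis exp_gt_zero ln_exp ln_less_cancel_iff)
    then have lnx1: "ln x > 1" by (meson less_trans one_less_exp_iff zero_less_one)
    have lnlnx: "ln (ln x) > 1" using lnx lnx1 by (metis exp_gt_zero less_trans ln_exp ln_less_cancel_iff zero_less_one)
    have mlog_eq: "mlog (mlog x) = ln (ln x)" using lnx1 lnlnx by (simp add: mlog_def)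
    let ?r = "mlog (mlog x) powr (1/7)"
    have r: "?r > 0" using mlog_pos[of "mlog x"] by simp
    show ?thesis
    proof (cases "x \<ge> x0")
      case True
      then have "real (card {n \<in> setC. real n \<le> x}) \<le> C * x / ?r"
        using x0 xpos by (simp add: setC_upto mlog_eq)
      also have "\<dots> \<le> (C + K) * x / ?r"
        using K r xpos by (intro divide_right_mono mult_right_mono) auto
      finally show ?thesis .
    next
      case False
      have "card {n \<in> setC. real n \<le> x} \<le> card {1..nat \<lfloor>x\<rfloor>}"
        unfolding setC_upto[OF xpos] by (intro card_mono) auto
      then have "real (card {n \<in> setC. real n \<le> x}) \<le> x"
        using xpos by simp linarith
      moreover have "?r \<le> K"
        unfolding K_def using False xpos mlog_pos
        by (intro powr_mono2 mlog_mono) (auto simp: less_imp_le)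
      then have "x * ?r \<le> (C + K) * x"
        using C xpos mult_left_mono[of ?r "C + K" x] by (simp add: mult.commute)
      then have "x \<le> (C + K) * x / ?r" using r by (simp add: pos_le_divide_eq)
      ultimately show ?thesis by linarith
    qed
  qed
  moreover have "C + K > 0" using C K by simp
  ultimately show ?thesis by blast
qed

theorem mainTheorem9:
  shows "(\<exists>c>0. \<forall>x::real. x > exp (exp 1) \<longrightarrow>
            real (card {n \<in> setC. real n \<le> x}) \<le> c * x / (mlog (mlog x)) powr (1/7))
         \<and> ((\<lambda>x::real. real (card {n \<in> setC. real n \<le> x}) / x) \<longlongrightarrow> 0) at_top"
proof
  show count: "\<exists>c>0. \<forall>x::real. x > exp (exp 1) \<longrightarrow>
      real (card {n \<in> setC. real n \<le> x}) \<le> c * x / (mlog (mlog x)) powr (1/7)"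
    by (rule card_setC_mlog)
  then obtain c where c: "\<And>x::real. x > exp (exp 1) \<Longrightarrow>
      real (card {n \<in> setC. real n \<le> x}) \<le> c * x / (mlog (mlog x)) powr (1/7)"
    by blast
  show "((\<lambda>x::real. real (card {n \<in> setC. real n \<le> x}) / x) \<longlongrightarrow> 0) at_top"
  proof (rule tendsto_sandwich)
    show "((\<lambda>_::real. 0::real) \<longlongrightarrow> 0) at_top" by simp
    have "((\<lambda>x::real. 1 / (max (ln (max (ln x) 1)) 1) powr (1/7)) \<longlongrightarrow> 0) at_top"
      by real_asymp
    then have "((\<lambda>x::real. c * (1 / (mlog (mlog x)) powr (1/7))) \<longlongrightarrow> c * 0) at_top"
      unfolding mlog_def by (intro tendsto_mult tendsto_const)
    then show "((\<lambda>x::real. c / (mlog (mlog x)) powr (1/7)) \<longlongrightarrow> 0) at_top" by simp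
    show "eventually (\<lambda>x::real. 0 \<le> real (card {n \<in> setC. real n \<le> x}) / x) at_top"
      using eventually_ge_at_top[of 0] by eventually_elim simp
    show "eventually (\<lambda>x::real. real (card {n \<in> setC. real n \<le> x}) / x
        \<le> c / (mlog (mlog x)) powr (1/7)) at_top"
      using eventually_gt_at_top[of "exp (exp 1)"]
    proof eventually_elim
      case (elim x)
      then have "x > 0" by (meson exp_gt_zero less_trans)
      with c[OF elim] show ?case by (simp add: field_simps)
    qed
  qed
qed

end
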